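(* Let $A$ be an $m\times n$ matrix over a field. Run on $A$, the algorithm $\mathtt{PLUQ}$ described in the context returns an $m\times m$ permutation matrix $P$, an $n\times n$ permutation matrix $Q$, the integer $r=\operatorname{rank}(A)$, an $r\times r$ unit lower triangular matrix $L$, an $(m-r)\times r$ matrix $M$, an $r\times r$ upper triangular matrix $U$ and an $r\times (n-r)$ matrix $V$ such that $$A= P \begin{bmatrix} L\\ M \end{bmatrix} \begin{bmatrix} U&V \end{bmatrix} Q .$$
   Context: Blocks may have zero dimensions; the product of an $a\times 0$ matrix by a $0\times b$ matrix is the $a\times b$ zero matrix, and a matrix with no rows or no columns is decomposed trivially with rank $0$ and identity permutations. $T_{1,i}$ is the permutation matrix of the transposition of the indices $1$ and $i$ (identity if $i=1$). $\mathrm{Diag}$ denotes a block diagonal matrix. Algorithm $\mathtt{PLUQ}$ on an $m\times n$ matrix $A$: Base case $m=1$. If $A=0$: $P=[1]$, $Q=I_n$, $r=0$. Otherwise let $i$ be the column index of the first nonzero entry: $P=[1]$, $Q=T_{1,i}$, $r=1$, $L=[1]$, $M$ empty, $[U\ V]=A\,T_{1,i}$. Base case $n=1$. If $A=0$: $P=I_m$, $Q=[1]$, $r=0$. Otherwise let $i$ be the row index of the first nonzero entry $a_i$: $P=T_{1,i}$, $Q=[1]$, $r=1$, $U=[a_i]$, $V$ empty, $\begin{bmatrix}L\\ M\end{bmatrix}=T_{1,i}A\,a_i^{-1}$. Otherwise put $k=\lfloor m/2\rfloor$, $h=\lfloor n/2\rfloor$ and split $A=\begin{bmatrix}A_1&A_2\\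 A_3&A_4\end{bmatrix}$ with $A_1$ of size $k\times h$. 1. Recursively decompose $A_1=P_1\begin{bmatrix}L_1\\ M_1\end{bmatrix}[U_1\ V_1]Q_1$, of rank $r_1$. 2. Set $\begin{bmatrix}B_1\\ B_2\end{bmatrix}=P_1^TA_2$ ($B_1$ with $r_1$ rows), $[C_1\ C_2]=A_3Q_1^T$ ($C_1$ with $r_1$ columns), $D=L_1^{-1}B_1$, $E=C_1U_1^{-1}$, $F=B_2-M_1D$, $G=C_2-EV_1$, $H=A_4-ED$. 3. Recursively decompose $F=P_2\begin{bmatrix}L_2\\ M_2\end{bmatrix}[U_2\ V_2]Q_2$ (rank $r_2$) and $G=P_3\begin{bmatrix}L_3\\ M_3\end{bmatrix}[U_3\ V_3]Q_3$ (rank $r_3$). 4. Set $\begin{bmatrix}H_1&H_2\\ H_3&H_4\end{bmatrix}=P_3^THQ_2^T$ ($H_1$ of size $r_3\times r_2$), $\begin{bmatrix}E_1\\ E_2\end{bmatrix}=P_3^TE$ ($E_1$ with $r_3$ rows), $\begin{bmatrix}M_{11}\\ M_{12}\end{bmatrix}=P_2^TM_1$ ($M_{11}$ with $r_2$ rows), $[D_1\ D_2]=DQ_2^T$ ($D_1$ with $r_2$ columns), $[V_{11}\ V_{12}]=V_1Q_3^T$ ($V_{11}$ with $r_3$ columns). 5. Set $X=H_1U_2^{-1}$, $J=L_3^{-1}X$, $K=H_3U_2^{-1}$, $N=L_3^{-1}H_2$, $O=N-JV_2$, $W=H_4-KV_2-M_3O$. 6. Recursively decompose $W=P_4\begin{bmatrix}L_4\\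 M_4\end{bmatrix}[U_4\ V_4]Q_4$ (rank $r_4$). Set $\begin{bmatrix}E_{21}&M_{31}&K_1\\ E_{22}&M_{32}&K_2\end{bmatrix}=P_4^T[E_2\ M_3\ K]$ (top blocks with $r_4$ rows) and $\begin{bmatrix}D_{21}&D_{22}\\ V_{21}&V_{22}\\ O_1&O_2\end{bmatrix}=\begin{bmatrix}D_2\\ V_2\\ O\end{bmatrix}Q_4^T$ (left blocks with $r_4$ columns). 7. Set $$S=\begin{bmatrix}I_{r_1+r_2}&0&0&0\\ 0&0&I_{k-r_1-r_2}&0\\ 0&I_{r_3+r_4}&0&0\\ 0&0&0&I_{m-k-r_3-r_4}\end{bmatrix},\quad T=\begin{bmatrix}I_{r_1}&0&0&0&0&0\\ 0&0&0&I_{r_2}&0&0\\ 0&I_{r_3}&0&0&0&0\\ 0&0&0&0&I_{r_4}&0\\ 0&0&I_{h-r_1-r_3}&0&0&0\\ 0&0&0&0&0&I_{n-h-r_2-r_4}\end{bmatrix},$$ $P=\mathrm{Diag}\big(P_1\mathrm{Diag}(I_{r_1},P_2),\,P_3\mathrm{Diag}(I_{r_3},P_4)\big)S$ and $Q=T\,\mathrm{Diag}\big(\mathrm{Diag}(I_{r_1},Q_3)Q_1,\,\mathrm{Diag}(I_{r_2},Q_4)Q_2\big)$. 8. Return $P$, $Q$, $r=r_1+r_2+r_3+r_4$ and $$L=\begin{bmatrix}L_1&0&0&0\\ M_{11}&L_2&0&0\\ E_1&X&L_3&0\\ E_{21}&K_1&M_{31}&L_4\end{bmatrix},\ M=\begin{bmatrix}M_{12}&M_2&0&0\\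 E_{22}&K_2&M_{32}&M_4\end{bmatrix},$$ $$U=\begin{bmatrix}U_1&D_1&V_{11}&D_{21}\\ 0&U_2&0&V_{21}\\ 0&0&U_3&O_1\\ 0&0&0&U_4\end{bmatrix},\ V=\begin{bmatrix}V_{12}&D_{22}\\ 0&V_{22}\\ V_3&O_2\\ 0&V_4\end{bmatrix}.$$ *)

theory Defs
  imports "Jordan_Normal_Form.DL_Rank" "HOL-Combinatorics.Permutations"
begin

definition permutation_mat :: "nat \<Rightarrow> 'a::zero_neq_one mat \<Rightarrow> bool" where
  "permutation_mat n P \<longleftrightarrow>
     (\<exists>p. p permutes {..<n} \<and> P = mat n n (\<lambda>(i, j). if j = p i then 1 else 0))"

definition unit_lower_triangular :: "'a::zero_neq_one mat \<Rightarrow> bool" where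
  "unit_lower_triangular A \<longleftrightarrow>
     (\<forall>i < dim_row A. A $$ (i, i) = 1 \<and> (\<forall>j < dim_col A. i < j \<longrightarrow> A $$ (i, j) = 0))"

definition append_cols :: "'a::zero mat \<Rightarrow> 'a mat \<Rightarrow> 'a mat" (infixr \<open>@\<^sub>c\<close> 66) where
  "A @\<^sub>c B = four_block_mat A B (0\<^sub>m 0 (dim_col A)) (0\<^sub>m 0 (dim_col B))"

definition split_rows :: "nat \<Rightarrow> 'a mat \<Rightarrow> 'a mat \<times> 'a mat" where
  "split_rows r A = (let (B, _, C, _) = split_block A r (dim_col A) in (B, C))"

definition split_cols :: "nat \<Rightarrow> 'a mat \<Rightarrow> 'a mat \<times> 'a mat" where
  "split_cols c A = (let (B, C, _, _) = split_block A (dim_row A) c in (B, C))"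

text \<open>Unspecified on singular matrices; the algorithm only inverts nonsingular triangular ones.\<close>

definition mat_inv :: "'a::field mat \<Rightarrow> 'a mat" where
  "mat_inv A = the (mat_inverse A)"

text \<open>Indices are counted from \<open>0\<close>, so \<open>swaprows_mat n 0 i\<close> is the matrix of the
  transposition of the first index and \<open>i\<close>. The dimensions \<open>m\<close> and \<open>n\<close> of the input are passed
  explicitly, which makes termination independent of the results of the recursive calls.
  The result is \<open>(P, Q, r, L, M, U, V)\<close>. The block called $O$ in the literature is named \<open>Z\<close>,
  since \<open>O\<close> is the infix symbol of relational composition.\<close>

function PLUQ :: "nat \<Rightarrow> nat \<Rightarrow> 'a::field mat
    \<Rightarrow> 'a mat \<times> 'a mat \<times> nat \<times> 'a mat \<times> 'a mat \<times> 'a mat \<times> 'a mat" where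
  "PLUQ m n A =
    (if m = 0 \<or> n = 0 then
       (1\<^sub>m m, 1\<^sub>m n, 0, 0\<^sub>m 0 0, 0\<^sub>m m 0, 0\<^sub>m 0 0, 0\<^sub>m 0 n)
     else if m = 1 then
       (if A = 0\<^sub>m m n then
          (1\<^sub>m m, 1\<^sub>m n, 0, 0\<^sub>m 0 0, 0\<^sub>m m 0, 0\<^sub>m 0 0, 0\<^sub>m 0 n)
        else
          let i = (LEAST j. j < n \<and> A $$ (0, j) \<noteq> 0);
              (U, V) = split_cols 1 (A * swaprows_mat n 0 i)
          in (1\<^sub>m 1, swaprows_mat n 0 i, 1, 1\<^sub>m 1, 0\<^sub>m 0 1, U, V))
     else if n = 1 then
       (if A = 0\<^sub>m m n then
          (1\<^sub>m m, 1\<^sub>m n, 0, 0\<^sub>m 0 0, 0\<^sub>m m 0, 0\<^sub>m 0 0, 0\<^sub>m 0 n)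
        else
          let i = (LEAST j. j < m \<and> A $$ (j, 0) \<noteq> 0);
              a = A $$ (i, 0);
              (L, M) = split_rows 1 (inverse a \<cdot>\<^sub>m (swaprows_mat m 0 i * A))
          in (swaprows_mat m 0 i, 1\<^sub>m 1, 1, L, M, mat 1 1 (\<lambda>_. a), 0\<^sub>m 1 0))
     else
       let k = m div 2; h = n div 2;
           (A1, A2, A3, A4) = split_block A k h;

           (P1, Q1, r1, L1, M1, U1, V1) = PLUQ k h A1;

           (B1, B2) = split_rows r1 (transpose_mat P1 * A2);
           (C1, C2) = split_cols r1 (A3 * transpose_mat Q1);
           D = mat_inv L1 * B1;
           E = C1 * mat_inv U1;
           F = B2 - M1 * D;
           G = C2 - E * V1;
           H = A4 - E * D;

           (P2, Q2, r2, L2, M2, U2, V2) = PLUQ (k - r1) (n - h) F;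
           (P3, Q3, r3, L3, M3, U3, V3) = PLUQ (m - k) (h - r1) G;

           (H1, H2, H3, H4) = split_block (transpose_mat P3 * H * transpose_mat Q2) r3 r2;
           (E1, E2) = split_rows r3 (transpose_mat P3 * E);
           (M11, M12) = split_rows r2 (transpose_mat P2 * M1);
           (D1, D2) = split_cols r2 (D * transpose_mat Q2);
           (V11, V12) = split_cols r3 (V1 * transpose_mat Q3);

           X = H1 * mat_inv U2;
           J = mat_inv L3 * X;
           K = H3 * mat_inv U2;
           N = mat_inv L3 * H2;
           Z = N - J * V2;
           W = H4 - K * V2 - M3 * Z;

           (P4, Q4, r4, L4, M4, U4, V4) = PLUQ (m - k - r3) (n - h - r2) W;
           (E21, E22) = split_rows r4 (transpose_mat P4 * E2);
           (M31, M32) = split_rows r4 (transpose_mat P4 * M3);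
           (K1, K2) = split_rows r4 (transpose_mat P4 * K);
           (D21, D22) = split_cols r4 (D2 * transpose_mat Q4);
           (V21, V22) = split_cols r4 (V2 * transpose_mat Q4);
           (O1, O2) = split_cols r4 (Z * transpose_mat Q4);

           m1 = k - r1 - r2; m2 = m - k - r3 - r4;
           n1 = h - r1 - r3; n2 = n - h - r2 - r4;
           S = (1\<^sub>m (r1+r2) @\<^sub>c 0\<^sub>m (r1+r2) (r3+r4) @\<^sub>c 0\<^sub>m (r1+r2) m1 @\<^sub>c 0\<^sub>m (r1+r2) m2) @\<^sub>r
               (0\<^sub>m m1 (r1+r2) @\<^sub>c 0\<^sub>m m1 (r3+r4) @\<^sub>c 1\<^sub>m m1 @\<^sub>c 0\<^sub>m m1 m2) @\<^sub>r
               (0\<^sub>m (r3+r4) (r1+r2) @\<^sub>c 1\<^sub>m (r3+r4) @\<^sub>c 0\<^sub>m (r3+r4) m1 @\<^sub>c 0\<^sub>m (r3+r4) m2) @\<^sub>r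
               (0\<^sub>m m2 (r1+r2) @\<^sub>c 0\<^sub>m m2 (r3+r4) @\<^sub>c 0\<^sub>m m2 m1 @\<^sub>c 1\<^sub>m m2);
           T = (1\<^sub>m r1 @\<^sub>c 0\<^sub>m r1 r3 @\<^sub>c 0\<^sub>m r1 n1 @\<^sub>c 0\<^sub>m r1 r2 @\<^sub>c 0\<^sub>m r1 r4 @\<^sub>c 0\<^sub>m r1 n2) @\<^sub>r
               (0\<^sub>m r2 r1 @\<^sub>c 0\<^sub>m r2 r3 @\<^sub>c 0\<^sub>m r2 n1 @\<^sub>c 1\<^sub>m r2 @\<^sub>c 0\<^sub>m r2 r4 @\<^sub>c 0\<^sub>m r2 n2) @\<^sub>r
               (0\<^sub>m r3 r1 @\<^sub>c 1\<^sub>m r3 @\<^sub>c 0\<^sub>m r3 n1 @\<^sub>c 0\<^sub>m r3 r2 @\<^sub>c 0\<^sub>m r3 r4 @\<^sub>c 0\<^sub>m r3 n2) @\<^sub>r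
               (0\<^sub>m r4 r1 @\<^sub>c 0\<^sub>m r4 r3 @\<^sub>c 0\<^sub>m r4 n1 @\<^sub>c 0\<^sub>m r4 r2 @\<^sub>c 1\<^sub>m r4 @\<^sub>c 0\<^sub>m r4 n2) @\<^sub>r
               (0\<^sub>m n1 r1 @\<^sub>c 0\<^sub>m n1 r3 @\<^sub>c 1\<^sub>m n1 @\<^sub>c 0\<^sub>m n1 r2 @\<^sub>c 0\<^sub>m n1 r4 @\<^sub>c 0\<^sub>m n1 n2) @\<^sub>r
               (0\<^sub>m n2 r1 @\<^sub>c 0\<^sub>m n2 r3 @\<^sub>c 0\<^sub>m n2 n1 @\<^sub>c 0\<^sub>m n2 r2 @\<^sub>c 0\<^sub>m n2 r4 @\<^sub>c 1\<^sub>m n2);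
           P = diag_block_mat
                 [P1 * diag_block_mat [1\<^sub>m r1, P2], P3 * diag_block_mat [1\<^sub>m r3, P4]] * S;
           Q = T * diag_block_mat
                 [diag_block_mat [1\<^sub>m r1, Q3] * Q1, diag_block_mat [1\<^sub>m r2, Q4] * Q2];

           L = (L1 @\<^sub>c 0\<^sub>m r1 r2 @\<^sub>c 0\<^sub>m r1 r3 @\<^sub>c 0\<^sub>m r1 r4) @\<^sub>r
               (M11 @\<^sub>c L2 @\<^sub>c 0\<^sub>m r2 r3 @\<^sub>c 0\<^sub>m r2 r4) @\<^sub>r
               (E1 @\<^sub>c X @\<^sub>c L3 @\<^sub>c 0\<^sub>m r3 r4) @\<^sub>r
               (E21 @\<^sub>c K1 @\<^sub>c M31 @\<^sub>c L4);
           M = (M12 @\<^sub>c M2 @\<^sub>c 0\<^sub>m m1 r3 @\<^sub>c 0\<^sub>m m1 r4) @\<^sub>r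
               (E22 @\<^sub>c K2 @\<^sub>c M32 @\<^sub>c M4);
           U = (U1 @\<^sub>c D1 @\<^sub>c V11 @\<^sub>c D21) @\<^sub>r
               (0\<^sub>m r2 r1 @\<^sub>c U2 @\<^sub>c 0\<^sub>m r2 r3 @\<^sub>c V21) @\<^sub>r
               (0\<^sub>m r3 r1 @\<^sub>c 0\<^sub>m r3 r2 @\<^sub>c U3 @\<^sub>c O1) @\<^sub>r
               (0\<^sub>m r4 r1 @\<^sub>c 0\<^sub>m r4 r2 @\<^sub>c 0\<^sub>m r4 r3 @\<^sub>c U4);
           V = (V12 @\<^sub>c D22) @\<^sub>r
               (0\<^sub>m r2 n1 @\<^sub>c V22) @\<^sub>r
               (V3 @\<^sub>c O2) @\<^sub>r
               (0\<^sub>m r4 n1 @\<^sub>c V4)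
       in (P, Q, r1 + r2 + r3 + r4, L, M, U, V))"
  by pat_completeness auto

termination
  by (relation "measure (\<lambda>(m, n, _). m + n)") auto

declare PLUQ.simps [simp del]

end

theory Submission
  imports Defs
begin

text \<open>
  The proof is by induction on the recursion, for an invariant \<open>is_PLUQ\<close> that is
  stronger than the conclusion in one point: the diagonal of \<open>U\<close> has no zero. This is what makes
  the inverses taken by the algorithm genuine inverses at the next level, and it also yields the
  claim on the rank, because a product of a left invertible \<open>m \<times> r\<close> matrix and a right invertible
  \<open>r \<times> n\<close> matrix has rank \<open>r\<close> (lemma \<open>rank_of_factorization\<close>).

  In the recursive step, \<open>S\<close> and \<open>T\<close> only undo a reordering of blocks. Once
  they are absorbed into the two factors, the factors follow the quadrant structure of \<open>A\<close>.
  With \<open>Y\<^sub>i = P\<^sub>i [L\<^sub>i; M\<^sub>i]\<close> and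
  \<open>R\<^sub>i = [U\<^sub>i V\<^sub>i] Q\<^sub>i\<close> the left factor
  (lemmas \<open>left_factor\<close>, \<open>left_factor_top\<close>, \<open>left_factor_bottom\<close>) has the block rows
  \<open>[Y\<^sub>1, P\<^sub>1 [0; Y\<^sub>2], 0, 0]\<close> and
  \<open>[E, P\<^sub>3 [X; K], Y\<^sub>3, P\<^sub>3 [0; Y\<^sub>4]]\<close>, and the right factor (lemma \<open>right_factor\<close>)
  has the block columns \<open>[R\<^sub>1; 0; [0 R\<^sub>3] Q\<^sub>1; 0]\<close> and
  \<open>[D; R\<^sub>2; [0 Z] Q\<^sub>2; [0 R\<^sub>4] Q\<^sub>2]\<close>.
  Their product (lemma \<open>block_product\<close>) is compared with \<open>A\<close> quadrant by quadrant. The recursive calls give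
  \<open>Y\<^sub>1 R\<^sub>1 = A\<^sub>1\<close>, \<open>Y\<^sub>2 R\<^sub>2 = F\<close>, \<open>Y\<^sub>3 R\<^sub>3 = G\<close>, \<open>Y\<^sub>4 R\<^sub>4 = W\<close>,
  and \<open>F\<close>, \<open>G\<close>, \<open>W\<close> were defined as what is left of \<open>A\<^sub>2\<close>, \<open>A\<^sub>3\<close>,
  \<open>A\<^sub>4\<close>, up to permutations, after subtracting the other contributions (lemma \<open>is_PLUQ_step\<close>).

  Products of block matrices are computed by rewriting with equations for \<open>@\<^sub>r\<close> and \<open>@\<^sub>c\<close>
  whose side conditions are equations between dimensions.
\<close>

section \<open>Block matrices\<close>

lemma dim_append_rows [simp]:
  "dim_row (A @\<^sub>r B) = dim_row A + dim_row B" "dim_col (A @\<^sub>r B) = dim_col A"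
  by (simp_all add: append_rows_def)

lemma dim_append_cols [simp]:
  "dim_row (A @\<^sub>c B) = dim_row A" "dim_col (A @\<^sub>c B) = dim_col A + dim_col B"
  by (simp_all add: append_cols_def)

lemma index_append_rows:
  assumes "i < dim_row A + dim_row B" "j < dim_col A"
  shows "(A @\<^sub>r B) $$ (i, j) = (if i < dim_row A then A $$ (i, j) else B $$ (i - dim_row A, j))"
  using assms by (simp add: append_rows_def)

lemma index_append_cols:
  assumes "i < dim_row A" "j < dim_col A + dim_col B"
  shows "(A @\<^sub>c B) $$ (i, j) = (if j < dim_col A then A $$ (i, j) else B $$ (i, j - dim_col A))"
  using assms by (simp add: append_cols_def)

lemma assoc_mult_dim:
  fixes A :: "'a::semiring_0 mat"
  shows "dim_col A = dim_row B \<Longrightarrow> dim_col B = dim_row C \<Longrightarrow> (A * B) * C = A * (B * C)"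
  by (rule assoc_mult_mat[of A "dim_row A" "dim_row B" B "dim_row C" C "dim_col C"]) auto

lemma zero_mult_dim: "dim_row C = q \<Longrightarrow> 0\<^sub>m p q * C = 0\<^sub>m p (dim_col C)" for C :: "'a::semiring_0 mat"
  by (rule left_mult_zero_mat) auto

lemma mult_zero_dim: "dim_col C = p \<Longrightarrow> C * 0\<^sub>m p q = 0\<^sub>m (dim_row C) q" for C :: "'a::semiring_0 mat"
  by (rule right_mult_zero_mat) auto

lemma one_mult_dim: "dim_row C = p \<Longrightarrow> 1\<^sub>m p * C = C" for C :: "'a::semiring_1 mat"
  by (rule left_mult_one_mat) auto

lemma mult_one_dim: "dim_col C = p \<Longrightarrow> C * 1\<^sub>m p = C" for C :: "'a::semiring_1 mat"
  by (rule right_mult_one_mat) auto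

lemma zero_add_dim: "dim_row C = p \<Longrightarrow> dim_col C = q \<Longrightarrow> 0\<^sub>m p q + C = C" for C :: "'a::monoid_add mat"
  by (rule left_add_zero_mat) auto

lemma add_zero_dim: "dim_row C = p \<Longrightarrow> dim_col C = q \<Longrightarrow> C + 0\<^sub>m p q = C" for C :: "'a::monoid_add mat"
  by (rule right_add_zero_mat) auto

lemmas zero_one_dim = zero_mult_dim mult_zero_dim one_mult_dim mult_one_dim zero_add_dim add_zero_dim

lemma mult_add_dim: "dim_col A = dim_row B \<Longrightarrow> dim_row B = dim_row C \<Longrightarrow> dim_col B = dim_col C \<Longrightarrow>
    A * (B + C) = A * B + A * C" for A :: "'a::semiring_0 mat"
  by (rule mult_add_distrib_mat[of _ "dim_row A" "dim_col A" _ "dim_col C"]) auto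

lemma add_mult_dim: "dim_col B = dim_row A \<Longrightarrow> dim_row B = dim_row C \<Longrightarrow> dim_col B = dim_col C \<Longrightarrow>
    (B + C) * A = B * A + C * A" for A :: "'a::semiring_0 mat"
  by (rule add_mult_distrib_mat[of _ "dim_row C" "dim_col C" _ _ "dim_col A"]) auto

lemma mult_minus_dim: "dim_col A = dim_row B \<Longrightarrow> dim_row B = dim_row C \<Longrightarrow> dim_col B = dim_col C \<Longrightarrow>
    A * (B - C) = A * B - A * C" for A :: "'a::ring mat"
  by (rule mult_minus_distrib_mat[of _ "dim_row A" "dim_col A" _ "dim_col C"]) auto

lemma add_diff_dim: "dim_row X = dim_row Y \<Longrightarrow> dim_col X = dim_col Y \<Longrightarrow> X + (Y - X) = Y" for X :: "'a::ab_group_add mat"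
  by (intro eq_matI) auto

lemma add_add_diff_dim: "dim_row X = dim_row Y \<Longrightarrow> dim_col X = dim_col Y \<Longrightarrow> dim_row X' = dim_row Y \<Longrightarrow> dim_col X' = dim_col Y
    \<Longrightarrow> X + (X' + (Y - X - X')) = Y" for X :: "'a::ab_group_add mat"
  by (intro eq_matI) auto

lemma append_rows_assoc:
  assumes "dim_col A = dim_col B"
  shows "(A @\<^sub>r B) @\<^sub>r C = A @\<^sub>r (B @\<^sub>r C)"
  using assms by (intro eq_matI) (auto simp: index_append_rows)

lemma append_cols_assoc:
  assumes "dim_row A = dim_row B"
  shows "(A @\<^sub>c B) @\<^sub>c C = A @\<^sub>c (B @\<^sub>c C)"
  using assms by (intro eq_matI) (auto simp: index_append_cols)

text \<open>
  Interchange law: a block matrix may be read by rows or by columns. Rewriting from left to right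
  turns a matrix given as a column of block rows into a row of block columns.
\<close>

lemma append_rows_of_append_cols:
  assumes "dim_row A = dim_row B" "dim_row C = dim_row D" "dim_col A = dim_col C" "dim_col B = dim_col D"
  shows "(A @\<^sub>c B) @\<^sub>r (C @\<^sub>c D) = (A @\<^sub>r C) @\<^sub>c (B @\<^sub>r D)"
  using assms by (intro eq_matI) (auto simp: index_append_rows index_append_cols)

lemma zero_append_rows: "0\<^sub>m a c @\<^sub>r 0\<^sub>m b c = 0\<^sub>m (a + b) c"
  by (intro eq_matI) (auto simp: index_append_rows)

lemma zero_append_cols: "0\<^sub>m a b @\<^sub>c 0\<^sub>m a c = 0\<^sub>m a (b + c)"
  by (intro eq_matI) (auto simp: index_append_cols)

lemma append_rows_mult:
  fixes A :: "'a::semiring_0 mat"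
  assumes "dim_col A = dim_row C" "dim_col B = dim_row C"
  shows "(A @\<^sub>r B) * C = A * C @\<^sub>r B * C"
  using assms
  by (intro eq_matI)
     (auto simp: index_append_rows scalar_prod_def intro!: sum.cong)

lemma mult_append_cols:
  fixes A :: "'a::semiring_0 mat"
  assumes "dim_col A = dim_row B" "dim_row B = dim_row C"
  shows "A * (B @\<^sub>c C) = A * B @\<^sub>c A * C"
  using assms
  by (intro eq_matI)
     (auto simp: index_append_cols scalar_prod_def intro!: sum.cong)

lemma append_cols_mult_append_rows:
  fixes A :: "'a::semiring_0 mat"
  assumes "dim_col A = dim_row C" "dim_col B = dim_row D" "dim_row A = dim_row B" "dim_col C = dim_col D"
  shows "(A @\<^sub>c B) * (C @\<^sub>r D) = A * C + B * D"
proof (rule eq_matI)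
  fix i j assume "i < dim_row (A * C + B * D)" and "j < dim_col (A * C + B * D)"
  then have ij: "i < dim_row B" "j < dim_col D" by auto
  have split: "{0..<dim_row C + dim_row D} = {0..<dim_row C} \<union> {dim_row C..<dim_row C + dim_row D}" by auto
  have shift: "(\<Sum>k\<in>{dim_row C..<dim_row C + dim_row D}. f k) = (\<Sum>k\<in>{0..<dim_row D}. f (k + dim_row C))"
    for f :: "nat \<Rightarrow> 'a"
    using sum.shift_bounds_nat_ivl[of f 0 "dim_row C" "dim_row D"] by (simp add: add.commute)
  show "((A @\<^sub>c B) * (C @\<^sub>r D)) $$ (i, j) = (A * C + B * D) $$ (i, j)"
    using ij assms
    by (simp add: scalar_prod_def split sum.union_disjoint shift index_append_rows index_append_cols
      cong: sum.cong_simp)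
qed (use assms in auto)

lemma append_cols_add:
  assumes "dim_row A = dim_row B" "dim_row C = dim_row D" "dim_row A = dim_row C"
    "dim_col A = dim_col C" "dim_col B = dim_col D"
  shows "(A @\<^sub>c B) + (C @\<^sub>c D) = (A + C) @\<^sub>c (B + D)"
  using assms by (intro eq_matI) (auto simp: index_append_cols)

lemma append_rows_add:
  assumes "dim_col A = dim_col B" "dim_col C = dim_col D" "dim_row A = dim_row C" "dim_row B = dim_row D"
    "dim_col A = dim_col C"
  shows "(A @\<^sub>r B) + (C @\<^sub>r D) = (A + C) @\<^sub>r (B + D)"
  using assms by (intro eq_matI) (auto simp: index_append_rows)

text \<open>
  Multiplies block matrices out down to the single blocks, where zero and identity blocks disappear.
\<close>

lemmas block_mult = append_rows_mult mult_append_cols append_cols_mult_append_rows zero_one_dim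

lemma diag_block_mat_pair:
  "diag_block_mat [A, B] = (A @\<^sub>c 0\<^sub>m (dim_row A) (dim_col B)) @\<^sub>r (0\<^sub>m (dim_row B) (dim_col A) @\<^sub>c B)"
  by (intro eq_matI) (auto simp: Let_def index_append_rows index_append_cols)

lemma dim_diag_block_mat_pair [simp]:
  "dim_row (diag_block_mat [A, B]) = dim_row A + dim_row B"
  "dim_col (diag_block_mat [A, B]) = dim_col A + dim_col B"
  by (simp_all add: dim_diag_block_mat)

lemma diag_block_mult_append_rows:
  fixes A :: "'a::semiring_1 mat"
  assumes "dim_col A = dim_row C" "dim_col B = dim_row D" "dim_col C = dim_col D"
  shows "diag_block_mat [A, B] * (C @\<^sub>r D) = A * C @\<^sub>r B * D"
  unfolding diag_block_mat_pair using assms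
  by (simp add: append_rows_mult append_cols_mult_append_rows zero_one_dim)

lemma append_cols_mult_diag_block:
  fixes A :: "'a::semiring_1 mat"
  assumes "dim_col C = dim_row A" "dim_col D = dim_row B" "dim_row C = dim_row D"
  shows "(C @\<^sub>c D) * diag_block_mat [A, B] = C * A @\<^sub>c D * B"
  unfolding diag_block_mat_pair using assms
  by (simp add: mult_append_cols append_cols_mult_append_rows zero_one_dim
      append_cols_add)

lemma mat_eq_append_rows:
  assumes "dim_row A = a + b"
  obtains B C where "A = B @\<^sub>r C" "dim_row B = a" "dim_row C = b" "dim_col B = dim_col A" "dim_col C = dim_col A"
proof
  show "A = mat a (dim_col A) (\<lambda>(i, j). A $$ (i, j)) @\<^sub>r mat b (dim_col A) (\<lambda>(i, j). A $$ (i + a, j))"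
    using assms by (intro eq_matI) (auto simp: index_append_rows)
qed auto

lemma split_rows_eq:
  assumes "split_rows r A = (B, C)" "dim_row A = r + s"
  shows "A = B @\<^sub>r C" "dim_row B = r" "dim_row C = s" "dim_col B = dim_col A" "dim_col C = dim_col A"
  using assms
  by (auto simp: split_rows_def split_block_def Let_def index_append_rows intro!: eq_matI)

lemma split_cols_eq:
  assumes "split_cols c A = (B, C)" "dim_col A = c + d"
  shows "A = B @\<^sub>c C" "dim_col B = c" "dim_col C = d" "dim_row B = dim_row A" "dim_row C = dim_row A"
  using assms
  by (auto simp: split_cols_def split_block_def Let_def index_append_cols intro!: eq_matI)

lemma split_block_eq:
  assumes "split_block A k h = (A1, A2, A3, A4)" "dim_row A = k + k'" "dim_col A = h + h'"
  shows "A = (A1 @\<^sub>c A2) @\<^sub>r (A3 @\<^sub>c A4)"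
    "dim_row A1 = k" "dim_row A2 = k" "dim_row A3 = k'" "dim_row A4 = k'"
    "dim_col A1 = h" "dim_col A2 = h'" "dim_col A3 = h" "dim_col A4 = h'"
  using assms
  by (auto simp: split_block_def Let_def index_append_rows index_append_cols intro!: eq_matI)

section \<open>Triangular matrices\<close>

lemma unit_lower_triangular_append:
  assumes "unit_lower_triangular A" "unit_lower_triangular C" "dim_row A = a" "dim_col A = a"
    "dim_row C = c" "dim_col C = c" "dim_row B = c" "dim_col B = a"
  shows "unit_lower_triangular ((A @\<^sub>c 0\<^sub>m a c) @\<^sub>r (B @\<^sub>c C))"
  using assms by (auto simp: unit_lower_triangular_def index_append_rows index_append_cols)

text \<open>
  The non-zero diagonal is carried along because \<open>U\<^sub>1\<close> and \<open>U\<^sub>2\<close> get inverted.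
\<close>

definition nonsing_upper_triangular :: "'a::zero mat \<Rightarrow> bool" where
  "nonsing_upper_triangular A \<longleftrightarrow> upper_triangular A \<and> (\<forall>i < dim_row A. A $$ (i, i) \<noteq> 0)"

lemma nonsing_upper_triangular_append:
  assumes "nonsing_upper_triangular A" "nonsing_upper_triangular C" "dim_row A = a" "dim_col A = a"
    "dim_row C = c" "dim_col C = c" "dim_row B = a" "dim_col B = c"
  shows "nonsing_upper_triangular ((A @\<^sub>c B) @\<^sub>r (0\<^sub>m c a @\<^sub>c C))"
  using assms
  by (auto simp: nonsing_upper_triangular_def upper_triangular_def index_append_rows index_append_cols)

lemma mat_inv_of_det:
  fixes A :: "'a::field mat"
  assumes "A \<in> carrier_mat n n" "det A \<noteq> 0"
  shows "A * mat_inv A = 1\<^sub>m n" "mat_inv A * A = 1\<^sub>m n" "mat_inv A \<in> carrier_mat n n"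
proof -
  from det_non_zero_imp_unit[OF assms, of "()"] mat_inverse(1)[OF assms(1), of "()"]
  obtain B where "mat_inverse A = Some B" by fastforce
  with mat_inverse(2)[OF assms(1) this]
  show "A * mat_inv A = 1\<^sub>m n" "mat_inv A * A = 1\<^sub>m n" "mat_inv A \<in> carrier_mat n n"
    by (simp_all add: mat_inv_def)
qed

lemma mat_inv_unit_lower_triangular:
  fixes L :: "'a::field mat"
  assumes "unit_lower_triangular L" "dim_row L = r" "dim_col L = r"
  shows "L * mat_inv L = 1\<^sub>m r" "mat_inv L * L = 1\<^sub>m r"
    "dim_row (mat_inv L) = r" "dim_col (mat_inv L) = r"
proof -
  have c: "L \<in> carrier_mat r r" using assms by auto
  have "diag_mat L = replicate r 1"
    using assms by (intro nth_equalityI) (auto simp: diag_mat_def unit_lower_triangular_def)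
  then have "det L = 1"
    using assms c
    by (subst det_lower_triangular[OF _ c]) (auto simp: unit_lower_triangular_def)
  with mat_inv_of_det[OF c] show "L * mat_inv L = 1\<^sub>m r" "mat_inv L * L = 1\<^sub>m r"
    "dim_row (mat_inv L) = r" "dim_col (mat_inv L) = r" by auto
qed

lemma mat_inv_nonsing_upper_triangular:
  fixes U :: "'a::field mat"
  assumes "nonsing_upper_triangular U" "dim_row U = r" "dim_col U = r"
  shows "U * mat_inv U = 1\<^sub>m r" "mat_inv U * U = 1\<^sub>m r"
    "dim_row (mat_inv U) = r" "dim_col (mat_inv U) = r"
proof -
  have c: "U \<in> carrier_mat r r" using assms by auto
  have "det U \<noteq> 0"
    using assms by (subst upper_triangular_imp_det_eq_0_iff[OF c])
      (auto simp: nonsing_upper_triangular_def diag_mat_def)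
  with mat_inv_of_det[OF c] show "U * mat_inv U = 1\<^sub>m r" "mat_inv U * U = 1\<^sub>m r"
    "dim_row (mat_inv U) = r" "dim_col (mat_inv U) = r" by auto
qed

section \<open>Permutation matrices\<close>

text \<open>
  Half of being a permutation matrix. This half can be read off from a block matrix row by row,
  which is how the matrices \<open>S\<close> and \<open>T\<close> are presented; the missing half, that no two rows agree,
  will come from invertibility.
\<close>

definition unit_rows :: "'a::zero_neq_one mat \<Rightarrow> bool" where
  "unit_rows A \<longleftrightarrow> (\<forall>i < dim_row A. \<exists>k < dim_col A. \<forall>j < dim_col A. A $$ (i, j) = (if j = k then 1 else 0))"

lemma unit_rows_one: "unit_rows (1\<^sub>m n)"
  by (auto simp: unit_rows_def)

lemma unit_rows_append_rows:
  assumes "unit_rows A" "unit_rows B" "dim_col A = dim_col B"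
  shows "unit_rows (A @\<^sub>r B)"
  unfolding unit_rows_def
proof (intro allI impI)
  fix i assume "i < dim_row (A @\<^sub>r B)"
  with assms show "\<exists>k < dim_col (A @\<^sub>r B). \<forall>j < dim_col (A @\<^sub>r B). (A @\<^sub>r B) $$ (i, j) = (if j = k then 1 else 0)"
    by (cases "i < dim_row A") (auto simp: unit_rows_def index_append_rows)
qed

lemma unit_rows_append_zero_cols:
  assumes "unit_rows A" "dim_row A = a"
  shows "unit_rows (A @\<^sub>c 0\<^sub>m a b)"
  unfolding unit_rows_def
proof (intro allI impI)
  fix i assume "i < dim_row (A @\<^sub>c 0\<^sub>m a b)"
  with assms obtain k where k: "k < dim_col A" "\<forall>j < dim_col A. A $$ (i, j) = (if j = k then 1 else 0)" "i < a"
    by (auto simp: unit_rows_def)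
  with assms show "\<exists>k < dim_col (A @\<^sub>c 0\<^sub>m a b). \<forall>j < dim_col (A @\<^sub>c 0\<^sub>m a b).
      (A @\<^sub>c 0\<^sub>m a b) $$ (i, j) = (if j = k then 1 else 0)"
    by (intro exI[of _ k]) (auto simp: index_append_cols)
qed

lemma unit_rows_zero_cols_append:
  assumes "unit_rows A" "dim_row A = a"
  shows "unit_rows (0\<^sub>m a b @\<^sub>c A)"
  unfolding unit_rows_def
proof (intro allI impI)
  fix i assume "i < dim_row (0\<^sub>m a b @\<^sub>c A)"
  with assms obtain k where k: "k < dim_col A" "\<forall>j < dim_col A. A $$ (i, j) = (if j = k then 1 else 0)" "i < a"
    by (auto simp: unit_rows_def)
  with assms show "\<exists>k < dim_col (0\<^sub>m a b @\<^sub>c A). \<forall>j < dim_col (0\<^sub>m a b @\<^sub>c A).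
      (0\<^sub>m a b @\<^sub>c A) $$ (i, j) = (if j = k then 1 else 0)"
    by (intro exI[of _ "b + k"]) (auto simp: index_append_cols)
qed

text \<open>
  If two rows of \<open>P\<close> were equal, so would be the corresponding rows of \<open>P * B = 1\<close>. Hence the map
  that sends a row to the position of its one is injective on a finite set, so it is a
  permutation.
\<close>

lemma permutation_matI:
  fixes P :: "'a::semiring_1 mat"
  assumes "P \<in> carrier_mat n n" "unit_rows P" "P * B = 1\<^sub>m n" "B \<in> carrier_mat n n"
  shows "permutation_mat n P"
proof -
  from assms(1,2) have "\<forall>i\<in>{..<n}. \<exists>k. k < n \<and> (\<forall>j < n. P $$ (i, j) = (if j = k then 1 else 0))"
    by (auto simp: unit_rows_def)
  then obtain q where q: "\<And>i. i < n \<Longrightarrow> q i < n"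
    "\<And>i j. i < n \<Longrightarrow> j < n \<Longrightarrow> P $$ (i, j) = (if j = q i then 1 else 0)"
    by (auto dest!: bchoice)
  have "inj_on q {..<n}"
  proof (rule inj_onI, rule ccontr)
    fix i i' assume i: "i \<in> {..<n}" "i' \<in> {..<n}" "q i = q i'" "i \<noteq> i'"
    then have "row P i = row P i'"
      using assms(1) q(2) by (intro eq_vecI) auto
    then have "(P * B) $$ (i, i) = (P * B) $$ (i', i)"
      using i assms(1,4) by simp
    with i assms(3) show False by simp
  qed
  moreover have "q ` {..<n} \<subseteq> {..<n}" using q(1) by auto
  ultimately have "bij_betw q {..<n} {..<n}"
    by (simp add: bij_betw_def endo_inj_surj)
  \<comment> \<open>A permutation of \<open>{..<n}\<close> has to fix all other numbers.\<close>
  define p where "p i = (if i < n then q i else i)" for i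
  have "p permutes {..<n}"
  proof (rule bij_imp_permutes)
    show "bij_betw p {..<n} {..<n}"
      using \<open>bij_betw q {..<n} {..<n}\<close> by (rule bij_betw_cong[THEN iffD1, rotated]) (simp add: p_def)
  qed (simp add: p_def)
  moreover have "P = mat n n (\<lambda>(i, j). if j = p i then 1 else 0)"
    using assms(1) q(2) by (intro eq_matI) (auto simp: p_def)
  ultimately show ?thesis by (auto simp: permutation_mat_def)
qed

lemma permutation_matE:
  fixes P :: "'a::semiring_1 mat"
  assumes "permutation_mat n P"
  shows "dim_row P = n" "dim_col P = n" "unit_rows P" "P * transpose_mat P = 1\<^sub>m n" "transpose_mat P * P = 1\<^sub>m n"
proof -
  from assms obtain p where p: "p permutes {..<n}" and P: "P = mat n n (\<lambda>(i, j). if j = p i then 1 else 0)"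
    by (auto simp: permutation_mat_def)
  have pn: "p i < n" if "i < n" for i
    using permutes_in_image[OF p, of i] that by simp
  have pinj: "p i = p j \<longleftrightarrow> i = j" for i j
    using permutes_inj[OF p] by (auto simp: inj_def)
  show "dim_row P = n" "dim_col P = n" by (simp_all add: P)
  show "unit_rows P" using pn by (auto simp: P unit_rows_def)
  show "P * transpose_mat P = 1\<^sub>m n"
    using pn pinj by (intro eq_matI) (auto simp: P scalar_prod_def if_distrib cong: if_cong)
  show "transpose_mat P * P = 1\<^sub>m n"
  proof (rule eq_matI)
    fix i j assume "i < dim_row (1\<^sub>m n :: 'a mat)" "j < dim_col (1\<^sub>m n :: 'a mat)"
    then have ij: "i < n" "j < n" by auto
    define q where "q = inv_into UNIV p"
    have q: "i = p k \<longleftrightarrow> k = q i" for i k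
      using permutes_inverses[OF p] by (auto simp: q_def)
    have "q i = q j \<longleftrightarrow> i = j"
      using permutes_inj[OF permutes_inv[OF p]] by (auto simp: q_def inj_def)
    moreover have "q i < n" if "i < n" for i
      using that permutes_in_image[OF permutes_inv[OF p], of i] by (simp add: q_def)
    ultimately show "(transpose_mat P * P) $$ (i, j) = 1\<^sub>m n $$ (i, j)"
      using ij by (auto simp: P scalar_prod_def q if_distrib cong: if_cong)
  qed (simp_all add: P)
qed

lemma mult_transpose_cancel:
  fixes X :: "'a::semiring_1 mat"
  assumes "permutation_mat n P" "transpose_mat P * X = Y" "dim_row X = n"
  shows "P * Y = X"
proof -
  note p = permutation_matE[OF assms(1)]
  have "P * Y = (P * transpose_mat P) * X"
    unfolding assms(2)[symmetric] by (subst assoc_mult_dim) (simp_all add: p assms(3))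
  then show ?thesis by (simp add: p(4) one_mult_dim assms(3))
qed

lemma transpose_mult_cancel:
  fixes X :: "'a::semiring_1 mat"
  assumes "permutation_mat n Q" "X * transpose_mat Q = Y" "dim_col X = n"
  shows "Y * Q = X"
proof -
  note p = permutation_matE[OF assms(1)]
  have "Y * Q = X * (transpose_mat Q * Q)"
    unfolding assms(2)[symmetric] by (subst assoc_mult_dim) (simp_all add: p assms(3))
  then show ?thesis by (simp add: p(5) mult_one_dim assms(3))
qed

text \<open>
  With the convention that row \<open>i\<close> has its one in column \<open>p i\<close>, products compose in the opposite
  order.
\<close>

lemma permutation_mat_mult:
  fixes P :: "'a::semiring_1 mat"
  assumes P: "permutation_mat n P" and Q: "permutation_mat n Q"
  shows "permutation_mat n (P * Q)"
proof -
  from P obtain p where p: "p permutes {..<n}" "P = mat n n (\<lambda>(i, j). if j = p i then 1 else 0)"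
    by (auto simp: permutation_mat_def)
  from Q obtain q where q: "q permutes {..<n}" "Q = mat n n (\<lambda>(i, j). if j = q i then 1 else 0)"
    by (auto simp: permutation_mat_def)
  have pn: "p i < n" if "i < n" for i
    using permutes_in_image[OF p(1), of i] that by simp
  have "P * Q = mat n n (\<lambda>(i, j). if j = (q \<circ> p) i then 1 else 0)"
    using pn by (intro eq_matI) (auto simp: p q scalar_prod_def if_distrib[where f = "\<lambda>x. x * y" for y] cong: if_cong)
  with permutes_compose[OF p(1) q(1)] show ?thesis
    by (auto simp: permutation_mat_def)
qed

lemma permutation_mat_one: "permutation_mat n (1\<^sub>m n :: 'a::semiring_1 mat)"
  by (rule permutation_matI[of _ _ "1\<^sub>m n"]) (auto simp: unit_rows_one)

lemma one_mat_append: "1\<^sub>m (a + b) = (1\<^sub>m a @\<^sub>c 0\<^sub>m a b) @\<^sub>r (0\<^sub>m b a @\<^sub>c 1\<^sub>m b)"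
  by (intro eq_matI) (auto simp: index_append_rows index_append_cols)

lemma permutation_mat_diag:
  fixes P :: "'a::semiring_1 mat"
  assumes P: "permutation_mat a P" and Q: "permutation_mat b Q"
  shows "permutation_mat (a + b) (diag_block_mat [P, Q])"
proof (rule permutation_matI)
  note p = permutation_matE[OF P] and q = permutation_matE[OF Q]
  show "diag_block_mat [P, Q] \<in> carrier_mat (a + b) (a + b)"
    by (intro carrier_matI) (simp_all add: p q del: diag_block_mat.simps)
  show "unit_rows (diag_block_mat [P, Q])"
    unfolding diag_block_mat_pair
    by (intro unit_rows_append_rows unit_rows_append_zero_cols unit_rows_zero_cols_append) (simp_all add: p q)
  let ?X = "(transpose_mat P @\<^sub>c 0\<^sub>m a b) @\<^sub>r (0\<^sub>m b a @\<^sub>c transpose_mat Q)"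
  show "diag_block_mat [P, Q] * ?X = 1\<^sub>m (a + b)"
    by (simp add: diag_block_mult_append_rows mult_append_cols p q zero_one_dim one_mat_append del: diag_block_mat.simps)
  show "?X \<in> carrier_mat (a + b) (a + b)"
    by (intro carrier_matI) (simp_all add: p q)
qed

lemma permutation_mat_swaprows:
  assumes "i < n"
  shows "permutation_mat n (swaprows_mat n 0 i :: 'a::semiring_1 mat)"
proof (rule permutation_matI)
  show "unit_rows (swaprows_mat n 0 i :: 'a mat)"
    unfolding unit_rows_def
  proof (intro allI impI)
    fix k assume "k < dim_row (swaprows_mat n 0 i :: 'a mat)"
    with assms show "\<exists>l < dim_col (swaprows_mat n 0 i :: 'a mat). \<forall>j < dim_col (swaprows_mat n 0 i :: 'a mat).
        (swaprows_mat n 0 i :: 'a mat) $$ (k, j) = (if j = l then 1 else 0)"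
      by (intro exI[of _ "if k = 0 then i else if k = i then 0 else k"]) auto
  qed
  show "swaprows_mat n 0 i * swaprows_mat n 0 i = (1\<^sub>m n :: 'a mat)"
    using assms by (intro swaprows_mat_inv) auto
qed auto

section \<open>The block permutations S and T\<close>

text \<open>
  The matrix \<open>S\<close>: the two middle blocks of rows, of heights \<open>b\<close> and \<open>c\<close>, change places.
\<close>

definition row_block_perm :: "nat \<Rightarrow> nat \<Rightarrow> nat \<Rightarrow> nat \<Rightarrow> 'a::semiring_1 mat" where
  "row_block_perm a b c d =
     (1\<^sub>m a @\<^sub>c 0\<^sub>m a b @\<^sub>c 0\<^sub>m a c @\<^sub>c 0\<^sub>m a d) @\<^sub>r
     (0\<^sub>m c a @\<^sub>c 0\<^sub>m c b @\<^sub>c 1\<^sub>m c @\<^sub>c 0\<^sub>m c d) @\<^sub>r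
     (0\<^sub>m b a @\<^sub>c 1\<^sub>m b @\<^sub>c 0\<^sub>m b c @\<^sub>c 0\<^sub>m b d) @\<^sub>r
     (0\<^sub>m d a @\<^sub>c 0\<^sub>m d b @\<^sub>c 0\<^sub>m d c @\<^sub>c 1\<^sub>m d)"

text \<open>
  The matrix \<open>T\<close>. Its columns are grouped by the two column halves of the input, its rows are
  sorted into the pivot blocks of the four recursive calls followed by the remaining columns.
\<close>

definition col_block_perm :: "nat \<Rightarrow> nat \<Rightarrow> nat \<Rightarrow> nat \<Rightarrow> nat \<Rightarrow> nat \<Rightarrow> 'a::semiring_1 mat" where
  "col_block_perm r1 r2 r3 r4 n1 n2 =
     (1\<^sub>m r1 @\<^sub>c 0\<^sub>m r1 r3 @\<^sub>c 0\<^sub>m r1 n1 @\<^sub>c 0\<^sub>m r1 r2 @\<^sub>c 0\<^sub>m r1 r4 @\<^sub>c 0\<^sub>m r1 n2) @\<^sub>r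
     (0\<^sub>m r2 r1 @\<^sub>c 0\<^sub>m r2 r3 @\<^sub>c 0\<^sub>m r2 n1 @\<^sub>c 1\<^sub>m r2 @\<^sub>c 0\<^sub>m r2 r4 @\<^sub>c 0\<^sub>m r2 n2) @\<^sub>r
     (0\<^sub>m r3 r1 @\<^sub>c 1\<^sub>m r3 @\<^sub>c 0\<^sub>m r3 n1 @\<^sub>c 0\<^sub>m r3 r2 @\<^sub>c 0\<^sub>m r3 r4 @\<^sub>c 0\<^sub>m r3 n2) @\<^sub>r
     (0\<^sub>m r4 r1 @\<^sub>c 0\<^sub>m r4 r3 @\<^sub>c 0\<^sub>m r4 n1 @\<^sub>c 0\<^sub>m r4 r2 @\<^sub>c 1\<^sub>m r4 @\<^sub>c 0\<^sub>m r4 n2) @\<^sub>r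
     (0\<^sub>m n1 r1 @\<^sub>c 0\<^sub>m n1 r3 @\<^sub>c 1\<^sub>m n1 @\<^sub>c 0\<^sub>m n1 r2 @\<^sub>c 0\<^sub>m n1 r4 @\<^sub>c 0\<^sub>m n1 n2) @\<^sub>r
     (0\<^sub>m n2 r1 @\<^sub>c 0\<^sub>m n2 r3 @\<^sub>c 0\<^sub>m n2 n1 @\<^sub>c 0\<^sub>m n2 r2 @\<^sub>c 0\<^sub>m n2 r4 @\<^sub>c 1\<^sub>m n2)"

lemma row_block_perm_mult:
  fixes A :: "'a::semiring_1 mat"
  assumes "dim_row A = a" "dim_row B = b" "dim_row C = c" "dim_row D = d"
    and "dim_col A = n" "dim_col B = n" "dim_col C = n" "dim_col D = n"
  shows "row_block_perm a b c d * (A @\<^sub>r B @\<^sub>r C @\<^sub>r D) = A @\<^sub>r C @\<^sub>r B @\<^sub>r D"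
  using assms
  by (simp add: row_block_perm_def append_rows_mult append_cols_mult_append_rows zero_one_dim)

lemma col_block_perm_mult:
  fixes A :: "'a::semiring_1 mat"
  assumes "dim_row A1 = r1" "dim_row A2 = r3" "dim_row A3 = n1" "dim_row A4 = r2" "dim_row A5 = r4" "dim_row A6 = n2"
    and "dim_col A1 = n" "dim_col A2 = n" "dim_col A3 = n" "dim_col A4 = n" "dim_col A5 = n" "dim_col A6 = n"
  shows "col_block_perm r1 r2 r3 r4 n1 n2 * (A1 @\<^sub>r A2 @\<^sub>r A3 @\<^sub>r A4 @\<^sub>r A5 @\<^sub>r A6)
    = A1 @\<^sub>r A4 @\<^sub>r A2 @\<^sub>r A5 @\<^sub>r A3 @\<^sub>r (A6 :: 'a mat)"
  using assms
  by (simp add: col_block_perm_def append_rows_mult append_cols_mult_append_rows zero_one_dim)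

lemma mult_col_block_perm:
  fixes A1 A2 A3 A4 A5 A6 :: "'a::semiring_1 mat"
  assumes "dim_col A1 = r1" "dim_col A2 = r2" "dim_col A3 = r3" "dim_col A4 = r4" "dim_col A5 = n1" "dim_col A6 = n2"
    and "dim_row A1 = m" "dim_row A2 = m" "dim_row A3 = m" "dim_row A4 = m" "dim_row A5 = m" "dim_row A6 = m"
  shows "(A1 @\<^sub>c A2 @\<^sub>c A3 @\<^sub>c A4 @\<^sub>c A5 @\<^sub>c A6) * col_block_perm r1 r2 r3 r4 n1 n2
    = A1 @\<^sub>c A3 @\<^sub>c A5 @\<^sub>c A2 @\<^sub>c A4 @\<^sub>c A6"
  using assms
  by (simp add: col_block_perm_def mult_append_cols append_cols_mult_append_rows append_cols_add zero_one_dim)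

text \<open>
  A right inverse need not be written down: cutting the identity into blocks of rows and putting
  them in the order expected by the selection rule makes the product the identity.
\<close>

lemma permutation_mat_row_block_perm:
  "permutation_mat (a + b + c + d) (row_block_perm a b c d :: 'a::semiring_1 mat)"
proof -
  let ?n = "a + b + c + d" and ?I = "1\<^sub>m (a + b + c + d) :: 'a mat"
  have I: "dim_row ?I = a + (c + (b + d))" "dim_col ?I = ?n" by simp_all
  obtain A X where 1: "?I = A @\<^sub>r X" "dim_row A = a" "dim_row X = c + (b + d)" "dim_col A = ?n" "dim_col X = ?n"
    using mat_eq_append_rows[OF I(1)] I(2) by metis
  obtain C Y where 2: "X = C @\<^sub>r Y" "dim_row C = c" "dim_row Y = b + d" "dim_col C = ?n" "dim_col Y = ?n"
    using mat_eq_append_rows[of X c "b + d"] 1 by metis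
  obtain B D where 3: "Y = B @\<^sub>r D" "dim_row B = b" "dim_row D = d" "dim_col B = ?n" "dim_col D = ?n"
    using mat_eq_append_rows[of Y b d] 2 by metis
  show ?thesis
  proof (rule permutation_matI)
    show "row_block_perm a b c d * (A @\<^sub>r B @\<^sub>r C @\<^sub>r D) = ?I"
      by (subst row_block_perm_mult[where n = ?n]) (simp_all only: 1 2 3)
    show "A @\<^sub>r B @\<^sub>r C @\<^sub>r D \<in> carrier_mat ?n ?n"
      by (intro carrier_matI) (simp_all add: 1 2 3)
    show "row_block_perm a b c d \<in> carrier_mat ?n ?n"
      by (intro carrier_matI) (simp_all add: row_block_perm_def)
    show "unit_rows (row_block_perm a b c d :: 'a mat)"
      unfolding row_block_perm_def
      by (simp add: unit_rows_append_rows unit_rows_append_zero_cols unit_rows_zero_cols_append unit_rows_one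
          zero_append_cols)
  qed
qed

lemma permutation_mat_col_block_perm:
  "permutation_mat (r1 + r2 + r3 + r4 + n1 + n2) (col_block_perm r1 r2 r3 r4 n1 n2 :: 'a::semiring_1 mat)"
proof -
  let ?n = "r1 + r2 + r3 + r4 + n1 + n2" and ?I = "1\<^sub>m (r1 + r2 + r3 + r4 + n1 + n2) :: 'a mat"
  have I: "dim_row ?I = r1 + (r2 + (r3 + (r4 + (n1 + n2))))" "dim_col ?I = ?n" by simp_all
  obtain A1 X1 where 1: "?I = A1 @\<^sub>r X1" "dim_row A1 = r1" "dim_row X1 = r2 + (r3 + (r4 + (n1 + n2)))"
    "dim_col A1 = ?n" "dim_col X1 = ?n"
    using mat_eq_append_rows[OF I(1)] I(2) by metis
  obtain A2 X2 where 2: "X1 = A2 @\<^sub>r X2" "dim_row A2 = r2" "dim_row X2 = r3 + (r4 + (n1 + n2))"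
    "dim_col A2 = ?n" "dim_col X2 = ?n"
    using mat_eq_append_rows[of X1 r2 "r3 + (r4 + (n1 + n2))"] 1 by metis
  obtain A3 X3 where 3: "X2 = A3 @\<^sub>r X3" "dim_row A3 = r3" "dim_row X3 = r4 + (n1 + n2)"
    "dim_col A3 = ?n" "dim_col X3 = ?n"
    using mat_eq_append_rows[of X2 r3 "r4 + (n1 + n2)"] 2 by metis
  obtain A4 X4 where 4: "X3 = A4 @\<^sub>r X4" "dim_row A4 = r4" "dim_row X4 = n1 + n2"
    "dim_col A4 = ?n" "dim_col X4 = ?n"
    using mat_eq_append_rows[of X3 r4 "n1 + n2"] 3 by metis
  obtain A5 A6 where 5: "X4 = A5 @\<^sub>r A6" "dim_row A5 = n1" "dim_row A6 = n2"
    "dim_col A5 = ?n" "dim_col A6 = ?n"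
    using mat_eq_append_rows[of X4 n1 n2] 4 by metis
  show ?thesis
  proof (rule permutation_matI)
    show "col_block_perm r1 r2 r3 r4 n1 n2 * (A1 @\<^sub>r A3 @\<^sub>r A5 @\<^sub>r A2 @\<^sub>r A4 @\<^sub>r A6) = ?I"
      by (subst col_block_perm_mult[where n = ?n]) (simp_all only: 1 2 3 4 5)
    show "A1 @\<^sub>r A3 @\<^sub>r A5 @\<^sub>r A2 @\<^sub>r A4 @\<^sub>r A6 \<in> carrier_mat ?n ?n"
      by (intro carrier_matI) (simp_all add: 1 2 3 4 5)
    show "col_block_perm r1 r2 r3 r4 n1 n2 \<in> carrier_mat ?n ?n"
      by (intro carrier_matI) (simp_all add: col_block_perm_def)
    show "unit_rows (col_block_perm r1 r2 r3 r4 n1 n2 :: 'a mat)"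
      unfolding col_block_perm_def
      by (simp add: unit_rows_append_rows unit_rows_append_zero_cols unit_rows_zero_cols_append unit_rows_one
          zero_append_cols)
  qed
qed

section \<open>Rank of a factorization\<close>

text \<open>
  The right inverse of \<open>C\<close> shows that \<open>B * C\<close> and \<open>B\<close> have the same column space, and the left
  inverse of \<open>B\<close> shows that the \<open>r\<close> columns of \<open>B\<close> are distinct and independent.
\<close>

lemma rank_of_factorization:
  fixes B C :: "'a::field mat"
  assumes B: "B \<in> carrier_mat m r" and C: "C \<in> carrier_mat r n"
    and B': "B' \<in> carrier_mat r m" "B' * B = 1\<^sub>m r"
    and C': "C' \<in> carrier_mat n r" "C * C' = 1\<^sub>m r"
  shows "vec_space.rank m (B * C) = r"
proof -
  interpret vec_space "TYPE('a)" m .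
  have B'B: "B' *\<^sub>v (B *\<^sub>v x) = x" if "x \<in> carrier_vec r" for x
    using that B B' by (simp flip: assoc_mult_mat_vec)
  have BC: "B * C \<in> carrier_mat m n" using B C by simp
  have "col_space (B * C) = col_space B"
  proof (intro equalityI subsetI)
    fix y assume "y \<in> col_space (B * C)"
    then obtain x where x: "x \<in> carrier_vec n" "y = (B * C) *\<^sub>v x" "y \<in> carrier_vec m"
      using B C by (auto simp: col_space_eq[OF BC])
    then have "y = B *\<^sub>v (C *\<^sub>v x)" using B C by simp
    then show "y \<in> col_space B" using x B C by (auto simp: col_space_eq[OF B])
  next
    fix y assume "y \<in> col_space B"
    then obtain x where x: "x \<in> carrier_vec r" "y = B *\<^sub>v x" "y \<in> carrier_vec m"
      using B by (auto simp: col_space_eq[OF B])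
    have "(B * C) *\<^sub>v (C' *\<^sub>v x) = B *\<^sub>v (C *\<^sub>v (C' *\<^sub>v x))"
      using B C C'(1) x(1) by simp
    also have "C *\<^sub>v (C' *\<^sub>v x) = (C * C') *\<^sub>v x"
      using C C'(1) x(1) by (rule assoc_mult_mat_vec[symmetric])
    finally have "(B * C) *\<^sub>v (C' *\<^sub>v x) = B *\<^sub>v ((C * C') *\<^sub>v x)" .
    also have "\<dots> = y" using x C' by simp
    finally show "y \<in> col_space (B * C)" using x B C C'
      by (auto simp: col_space_eq[OF BC] intro!: bexI[of _ "C' *\<^sub>v x"])
  qed
  then have "rank (B * C) = rank B" by (simp add: rank_def col_space_def)
  also have "rank B = r"
  proof (rule lin_indpt_full_rank[OF B])
    show distinct: "distinct (cols B)"
    proof (subst distinct_conv_nth, intro allI impI notI)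
      fix i j assume ij: "i < length (cols B)" "j < length (cols B)" "i \<noteq> j" "cols B ! i = cols B ! j"
      then have r: "i < r" "j < r" "col B i = col B j" using B by auto
      have "B' *\<^sub>v col B k = unit_vec r k" if "k < r" for k
        using that B B' by (metis col_mult2 col_one)
      with r have "unit_vec r i = (unit_vec r j :: 'a vec)" by metis
      then have "(unit_vec r i :: 'a vec) $ i = unit_vec r j $ i" by simp
      then show False using ij(3) r(1,2) by simp
    qed
    show "lin_indpt (set (cols B))"
    proof
      assume "lin_dep (set (cols B))"
      then obtain v where v: "v \<in> carrier_vec r" "v \<noteq> 0\<^sub>v r" "B *\<^sub>v v = 0\<^sub>v m"
        using lin_depE[OF B _ distinct] by blast
      have "v = B' *\<^sub>v (B *\<^sub>v v)" using B'B[OF v(1)] by simp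
      also have "\<dots> = 0\<^sub>v r" using v(3) B'(1) by auto
      finally show False using v(2) by simp
    qed
  qed
  finally show ?thesis .
qed

section \<open>The invariant\<close>

text \<open>
  The rank is not mentioned: it follows from the other properties. The two factors are associated
  to the outside, in the form in which the recursive step uses them.
\<close>

definition is_PLUQ :: "nat \<Rightarrow> nat \<Rightarrow> 'a::field mat
    \<Rightarrow> 'a mat \<times> 'a mat \<times> nat \<times> 'a mat \<times> 'a mat \<times> 'a mat \<times> 'a mat \<Rightarrow> bool" where
  "is_PLUQ m n A = (\<lambda>(P, Q, r, L, M, U, V).
     permutation_mat m P \<and> permutation_mat n Q \<and> r \<le> m \<and> r \<le> n \<and>
     dim_row L = r \<and> dim_col L = r \<and> unit_lower_triangular L \<and>
     dim_row M = m - r \<and> dim_col M = r \<and>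
     dim_row U = r \<and> dim_col U = r \<and> nonsing_upper_triangular U \<and>
     dim_row V = r \<and> dim_col V = n - r \<and>
     A = (P * (L @\<^sub>r M)) * ((U @\<^sub>c V) * Q))"

lemma is_PLUQD:
  assumes "is_PLUQ m n A (P, Q, r, L, M, U, V)"
  shows "permutation_mat m P" "permutation_mat n Q" "r \<le> m" "r \<le> n"
    "dim_row L = r" "dim_col L = r" "unit_lower_triangular L"
    "dim_row M = m - r" "dim_col M = r"
    "dim_row U = r" "dim_col U = r" "nonsing_upper_triangular U"
    "dim_row V = r" "dim_col V = n - r"
    "(P * (L @\<^sub>r M)) * ((U @\<^sub>c V) * Q) = A"
  using assms by (simp_all add: is_PLUQ_def)

text \<open>
  One-sided inverses of the two factors are obtained by padding the inverses of \<open>L\<close> and \<open>U\<close> with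
  zeros.
\<close>

lemma is_PLUQ_rank:
  fixes A :: "'a::field mat"
  assumes "is_PLUQ m n A (P, Q, r, L, M, U, V)"
  shows "vec_space.rank m A = r"
proof -
  note d = is_PLUQD[OF assms]
  note p = permutation_matE[OF d(1)] and q = permutation_matE[OF d(2)]
  note l = mat_inv_unit_lower_triangular[OF d(7,5,6)]
  note u = mat_inv_nonsing_upper_triangular[OF d(12,10,11)]
  note dims = d(5,6,8-11,13,14) p(1,2) q(1,2) l(3,4) u(3,4) le_add_diff_inverse[OF d(3)] le_add_diff_inverse[OF d(4)]
  let ?B' = "(mat_inv L @\<^sub>c 0\<^sub>m r (m - r)) * transpose_mat P"
  let ?C' = "transpose_mat Q * (mat_inv U @\<^sub>r 0\<^sub>m (n - r) r)"
  have "?B' * (P * (L @\<^sub>r M)) = (mat_inv L @\<^sub>c 0\<^sub>m r (m - r)) * ((transpose_mat P * P) * (L @\<^sub>r M))"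
    by (simp add: assoc_mult_dim dims)
  also have "\<dots> = 1\<^sub>m r"
    by (simp add: p(5) block_mult l dims)
  finally have B': "?B' * (P * (L @\<^sub>r M)) = 1\<^sub>m r" .
  have "((U @\<^sub>c V) * Q) * ?C' = (U @\<^sub>c V) * ((Q * transpose_mat Q) * (mat_inv U @\<^sub>r 0\<^sub>m (n - r) r))"
    by (simp add: assoc_mult_dim dims)
  also have "\<dots> = 1\<^sub>m r"
    by (simp add: q(4) block_mult u dims)
  finally have C': "((U @\<^sub>c V) * Q) * ?C' = 1\<^sub>m r" .
  have "vec_space.rank m ((P * (L @\<^sub>r M)) * ((U @\<^sub>c V) * Q)) = r"
    by (rule rank_of_factorization[OF _ _ _ B' _ C', where n = n]) (auto intro!: carrier_matI simp: dims)
  then show ?thesis by (simp only: d(15))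
qed

section \<open>Assembling the factors from the four recursive calls\<close>

text \<open>
  The pivot rows and the remaining rows of the upper half of \<open>A\<close> are separated in \<open>[L; M]\<close> by the
  pivot rows of the lower half; \<open>S\<close> brings the rows of each half together again.
\<close>

lemma left_factor:
  fixes Ra :: "'a::semiring_1 mat"
  assumes dims: "dim_row Ra = r1" "dim_row Rb = r2" "dim_row Rc = r3" "dim_row Rd = r4" "dim_row Ua = m1" "dim_row Ub = m2"
    "dim_col Ra = r" "dim_col Rb = r" "dim_col Rc = r" "dim_col Rd = r" "dim_col Ua = r" "dim_col Ub = r"
    "dim_col X = r1 + (r2 + m1)" "dim_col Y = r3 + (r4 + m2)"
  shows "diag_block_mat [X, Y] * row_block_perm (r1 + r2) (r3 + r4) m1 m2 * ((Ra @\<^sub>r Rb @\<^sub>r Rc @\<^sub>r Rd) @\<^sub>r (Ua @\<^sub>r Ub)) =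
    X * ((Ra @\<^sub>r Rb) @\<^sub>r Ua) @\<^sub>r Y * ((Rc @\<^sub>r Rd) @\<^sub>r Ub)"
    (is "?D * ?S * ?A = _")
proof -
  have d: "dim_row ?S = r1 + r2 + r3 + r4 + m1 + m2" "dim_col ?S = r1 + r2 + r3 + r4 + m1 + m2"
    by (simp_all add: row_block_perm_def)
  have "?A = (Ra @\<^sub>r Rb) @\<^sub>r (Rc @\<^sub>r Rd) @\<^sub>r Ua @\<^sub>r Ub"
    by (simp add: append_rows_assoc dims)
  then have S: "?S * ?A = (Ra @\<^sub>r Rb) @\<^sub>r Ua @\<^sub>r (Rc @\<^sub>r Rd) @\<^sub>r Ub"
    by (simp add: row_block_perm_mult[where n = r] dims)
  have "?D * ?S * ?A = ?D * (?S * ?A)"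
    by (subst assoc_mult_dim) (simp_all add: dims d del: diag_block_mat.simps)
  also have "\<dots> = ?D * (((Ra @\<^sub>r Rb) @\<^sub>r Ua) @\<^sub>r ((Rc @\<^sub>r Rd) @\<^sub>r Ub))"
    unfolding S by (simp add: append_rows_assoc dims del: diag_block_mat.simps)
  also have "\<dots> = X * ((Ra @\<^sub>r Rb) @\<^sub>r Ua) @\<^sub>r Y * ((Rc @\<^sub>r Rd) @\<^sub>r Ub)"
    by (subst diag_block_mult_append_rows) (simp_all add: dims)
  finally show ?thesis .
qed

text \<open>
  The permutation \<open>P\<^sub>2\<close> acts on the rows of \<open>M\<^sub>1\<close>, which had been permuted
  by its transpose; so \<open>M\<^sub>1\<close> reappears, next to the left factor of \<open>F\<close>.
\<close>

lemma left_factor_top: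
  fixes P1 :: "'a::semiring_1 mat"
  assumes dims: "dim_col P1 = r1 + (r2 + m1)" "dim_row P1 = r1 + (r2 + m1)"
    "dim_row P2 = r2 + m1" "dim_col P2 = r2 + m1"
    "dim_row L1 = r1" "dim_col L1 = r1" "dim_row L2 = r2" "dim_col L2 = r2" "dim_row M2 = m1" "dim_col M2 = r2"
    "dim_row M11 = r2" "dim_col M11 = r1" "dim_row M12 = m1" "dim_col M12 = r1"
    and M1: "P2 * (M11 @\<^sub>r M12) = M1"
  shows "P1 * diag_block_mat [1\<^sub>m r1, P2] *
      (((L1 @\<^sub>c 0\<^sub>m r1 r2 @\<^sub>c 0\<^sub>m r1 r3 @\<^sub>c 0\<^sub>m r1 r4) @\<^sub>r
        (M11 @\<^sub>c L2 @\<^sub>c 0\<^sub>m r2 r3 @\<^sub>c 0\<^sub>m r2 r4)) @\<^sub>r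
        (M12 @\<^sub>c M2 @\<^sub>c 0\<^sub>m m1 r3 @\<^sub>c 0\<^sub>m m1 r4))
    = P1 * (L1 @\<^sub>r M1) @\<^sub>c P1 * (0\<^sub>m r1 r2 @\<^sub>r P2 * (L2 @\<^sub>r M2)) @\<^sub>c
      0\<^sub>m (r1 + (r2 + m1)) r3 @\<^sub>c 0\<^sub>m (r1 + (r2 + m1)) r4"
proof -
  have dims': "dim_row M1 = r2 + m1" "dim_col M1 = r1" by (simp_all add: dims flip: M1)
  show ?thesis
    by (simp add: dims dims' M1 append_rows_assoc assoc_mult_dim diag_block_mult_append_rows append_rows_of_append_cols
      mult_append_cols zero_one_dim zero_append_rows del: diag_block_mat.simps)
qed

text \<open>
  The same cancellation for the lower half: \<open>P\<^sub>4\<close> restores \<open>E\<^sub>2\<close>,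
  \<open>K\<close> and \<open>M\<^sub>3\<close>, and \<open>P\<^sub>3\<close> then restores \<open>E\<close>.
\<close>

lemma left_factor_bottom:
  fixes P3 :: "'a::semiring_1 mat"
  assumes dims: "dim_col P3 = r3 + (r4 + m2)" "dim_row P3 = r3 + (r4 + m2)"
    "dim_row P4 = r4 + m2" "dim_col P4 = r4 + m2"
    "dim_row L3 = r3" "dim_col L3 = r3" "dim_row L4 = r4" "dim_col L4 = r4" "dim_row M4 = m2" "dim_col M4 = r4"
    "dim_row E1 = r3" "dim_col E1 = r1" "dim_row E21 = r4" "dim_col E21 = r1" "dim_row E22 = m2" "dim_col E22 = r1"
    "dim_row X = r3" "dim_col X = r2" "dim_row K1 = r4" "dim_col K1 = r2" "dim_row K2 = m2" "dim_col K2 = r2"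
    "dim_row M31 = r4" "dim_col M31 = r3" "dim_row M32 = m2" "dim_col M32 = r3"
    and E: "P4 * (E21 @\<^sub>r E22) = E2" "P3 * (E1 @\<^sub>r E2) = E"
    and K: "P4 * (K1 @\<^sub>r K2) = K" and M3: "P4 * (M31 @\<^sub>r M32) = M3"
  shows "P3 * diag_block_mat [1\<^sub>m r3, P4] *
      (((E1 @\<^sub>c X @\<^sub>c L3 @\<^sub>c 0\<^sub>m r3 r4) @\<^sub>r
        (E21 @\<^sub>c K1 @\<^sub>c M31 @\<^sub>c L4)) @\<^sub>r
        (E22 @\<^sub>c K2 @\<^sub>c M32 @\<^sub>c M4))
    = E @\<^sub>c P3 * (X @\<^sub>r K) @\<^sub>c P3 * (L3 @\<^sub>r M3) @\<^sub>c P3 * (0\<^sub>m r3 r4 @\<^sub>r P4 * (L4 @\<^sub>r M4))"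
proof -
  have dims': "dim_row E2 = r4 + m2" "dim_col E2 = r1" "dim_row K = r4 + m2" "dim_col K = r2"
    "dim_row M3 = r4 + m2" "dim_col M3 = r3" by (simp_all add: dims flip: E K M3)
  show ?thesis
    by (simp add: dims dims' E K M3 append_rows_assoc assoc_mult_dim diag_block_mult_append_rows append_rows_of_append_cols
      mult_append_cols zero_one_dim zero_append_rows del: diag_block_mat.simps)
qed

text \<open>
  One block row of the right factor: \<open>T\<close> gathers the columns of the left half and those of the
  right half, after which the two halves are multiplied independently.
\<close>

lemma right_factor_row:
  fixes Q1 :: "'a::semiring_1 mat"
  assumes dims: "dim_row Q1 = r1 + (r3 + n1)" "dim_col Q1 = r1 + (r3 + n1)"
    "dim_row Q3 = r3 + n1" "dim_col Q3 = r3 + n1"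
    "dim_row Q2 = r2 + (r4 + n2)" "dim_col Q2 = r2 + (r4 + n2)"
    "dim_row Q4 = r4 + n2" "dim_col Q4 = r4 + n2"
    "dim_col A1 = r1" "dim_col A2 = r2" "dim_col A3 = r3" "dim_col A4 = r4" "dim_col A5 = n1" "dim_col A6 = n2"
    "dim_row A1 = m" "dim_row A2 = m" "dim_row A3 = m" "dim_row A4 = m" "dim_row A5 = m" "dim_row A6 = m"
  shows "((A1 @\<^sub>c A2 @\<^sub>c A3 @\<^sub>c A4) @\<^sub>c (A5 @\<^sub>c A6)) *
      (col_block_perm r1 r2 r3 r4 n1 n2 *
       diag_block_mat [diag_block_mat [1\<^sub>m r1, Q3] * Q1, diag_block_mat [1\<^sub>m r2, Q4] * Q2])
    = (A1 @\<^sub>c (A3 @\<^sub>c A5) * Q3) * Q1 @\<^sub>c (A2 @\<^sub>c (A4 @\<^sub>c A6) * Q4) * Q2"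
    (is "?A * (?T * ?D) = _")
proof -
  have d: "dim_row ?T = r1 + r2 + r3 + r4 + n1 + n2" "dim_col ?T = r1 + r3 + n1 + r2 + r4 + n2"
    by (simp_all add: col_block_perm_def)
  have "?A * (?T * ?D) = (?A * ?T) * ?D"
    by (subst assoc_mult_dim) (simp_all add: dims d del: diag_block_mat.simps)
  also have "?A * ?T = A1 @\<^sub>c A3 @\<^sub>c A5 @\<^sub>c A2 @\<^sub>c A4 @\<^sub>c A6"
    by (simp add: dims append_cols_assoc mult_col_block_perm[where m = m])
  also have "\<dots> = (A1 @\<^sub>c A3 @\<^sub>c A5) @\<^sub>c (A2 @\<^sub>c A4 @\<^sub>c A6)"
    by (simp add: dims append_cols_assoc)
  also have "\<dots> * ?D = (A1 @\<^sub>c A3 @\<^sub>c A5) * (diag_block_mat [1\<^sub>m r1, Q3] * Q1) @\<^sub>c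
      (A2 @\<^sub>c A4 @\<^sub>c A6) * (diag_block_mat [1\<^sub>m r2, Q4] * Q2)"
    by (subst append_cols_mult_diag_block) (simp_all add: dims del: diag_block_mat.simps)
  also have "(A1 @\<^sub>c A3 @\<^sub>c A5) * (diag_block_mat [1\<^sub>m r1, Q3] * Q1) = (A1 @\<^sub>c (A3 @\<^sub>c A5) * Q3) * Q1"
    by (simp add: dims assoc_mult_dim[symmetric] append_cols_mult_diag_block zero_one_dim del: diag_block_mat.simps)
  also have "(A2 @\<^sub>c A4 @\<^sub>c A6) * (diag_block_mat [1\<^sub>m r2, Q4] * Q2) = (A2 @\<^sub>c (A4 @\<^sub>c A6) * Q4) * Q2"
    by (simp add: dims assoc_mult_dim[symmetric] append_cols_mult_diag_block zero_one_dim del: diag_block_mat.simps)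
  finally show ?thesis .
qed

lemma right_factor:
  fixes Q1 :: "'a::semiring_1 mat"
  assumes dims: "dim_row Q1 = r1 + (r3 + n1)" "dim_col Q1 = r1 + (r3 + n1)"
    "dim_row Q3 = r3 + n1" "dim_col Q3 = r3 + n1"
    "dim_row Q2 = r2 + (r4 + n2)" "dim_col Q2 = r2 + (r4 + n2)"
    "dim_row Q4 = r4 + n2" "dim_col Q4 = r4 + n2"
    "dim_row U1 = r1" "dim_col U1 = r1" "dim_row D1 = r1" "dim_col D1 = r2" "dim_row V11 = r1" "dim_col V11 = r3"
    "dim_row V12 = r1" "dim_col V12 = n1" "dim_row D21 = r1" "dim_col D21 = r4" "dim_row D22 = r1" "dim_col D22 = n2"
    "dim_row U2 = r2" "dim_col U2 = r2" "dim_row V21 = r2" "dim_col V21 = r4" "dim_row V22 = r2" "dim_col V22 = n2"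
    "dim_row U3 = r3" "dim_col U3 = r3" "dim_row V3 = r3" "dim_col V3 = n1"
    "dim_row O1 = r3" "dim_col O1 = r4" "dim_row O2 = r3" "dim_col O2 = n2"
    "dim_row U4 = r4" "dim_col U4 = r4" "dim_row V4 = r4" "dim_col V4 = n2"
    and D: "(D21 @\<^sub>c D22) * Q4 = D2" "(D1 @\<^sub>c D2) * Q2 = D"
    and V: "(V11 @\<^sub>c V12) * Q3 = V1" "(V21 @\<^sub>c V22) * Q4 = V2" and Z: "(O1 @\<^sub>c O2) * Q4 = Z"
  shows "(((U1 @\<^sub>c D1 @\<^sub>c V11 @\<^sub>c D21) @\<^sub>r
           (0\<^sub>m r2 r1 @\<^sub>c U2 @\<^sub>c 0\<^sub>m r2 r3 @\<^sub>c V21) @\<^sub>r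
           (0\<^sub>m r3 r1 @\<^sub>c 0\<^sub>m r3 r2 @\<^sub>c U3 @\<^sub>c O1) @\<^sub>r
           (0\<^sub>m r4 r1 @\<^sub>c 0\<^sub>m r4 r2 @\<^sub>c 0\<^sub>m r4 r3 @\<^sub>c U4)) @\<^sub>c
          ((V12 @\<^sub>c D22) @\<^sub>r (0\<^sub>m r2 n1 @\<^sub>c V22) @\<^sub>r (V3 @\<^sub>c O2) @\<^sub>r (0\<^sub>m r4 n1 @\<^sub>c V4))) *
      (col_block_perm r1 r2 r3 r4 n1 n2 *
       diag_block_mat [diag_block_mat [1\<^sub>m r1, Q3] * Q1, diag_block_mat [1\<^sub>m r2, Q4] * Q2])
    = ((U1 @\<^sub>c V1) * Q1 @\<^sub>r 0\<^sub>m r2 (r1 + (r3 + n1)) @\<^sub>r (0\<^sub>m r3 r1 @\<^sub>c (U3 @\<^sub>c V3) * Q3) * Q1 @\<^sub>r 0\<^sub>m r4 (r1 + (r3 + n1))) @\<^sub>c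
      (D @\<^sub>r (U2 @\<^sub>c V2) * Q2 @\<^sub>r (0\<^sub>m r3 r2 @\<^sub>c Z) * Q2 @\<^sub>r (0\<^sub>m r4 r2 @\<^sub>c (U4 @\<^sub>c V4) * Q4) * Q2)"
    (is "(?U @\<^sub>c ?V) * ?T = _")
proof -
  have t: "dim_row (col_block_perm r1 r2 r3 r4 n1 n2 :: 'a mat) = r1 + (r2 + (r3 + (r4 + (n1 + n2))))"
    by (simp add: col_block_perm_def)
  have d: "dim_row D2 = r1" "dim_col D2 = r4 + n2" "dim_row D = r1" "dim_col D = r2 + (r4 + n2)"
    "dim_row V1 = r1" "dim_col V1 = r3 + n1" "dim_row V2 = r2" "dim_col V2 = r4 + n2"
    "dim_row Z = r3" "dim_col Z = r4 + n2"
    by (simp_all add: dims flip: D V Z)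
  note row = right_factor_row[OF dims(1-8)]
  have "?U @\<^sub>c ?V =
      ((U1 @\<^sub>c D1 @\<^sub>c V11 @\<^sub>c D21) @\<^sub>c (V12 @\<^sub>c D22)) @\<^sub>r
      ((0\<^sub>m r2 r1 @\<^sub>c U2 @\<^sub>c 0\<^sub>m r2 r3 @\<^sub>c V21) @\<^sub>c (0\<^sub>m r2 n1 @\<^sub>c V22)) @\<^sub>r
      ((0\<^sub>m r3 r1 @\<^sub>c 0\<^sub>m r3 r2 @\<^sub>c U3 @\<^sub>c O1) @\<^sub>c (V3 @\<^sub>c O2)) @\<^sub>r
      ((0\<^sub>m r4 r1 @\<^sub>c 0\<^sub>m r4 r2 @\<^sub>c 0\<^sub>m r4 r3 @\<^sub>c U4) @\<^sub>c (0\<^sub>m r4 n1 @\<^sub>c V4))"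
    by (simp add: append_rows_of_append_cols append_cols_assoc dims)
  also have "\<dots> * ?T =
      ((U1 @\<^sub>c V1) * Q1 @\<^sub>c D) @\<^sub>r
      (0\<^sub>m r2 (r1 + (r3 + n1)) @\<^sub>c (U2 @\<^sub>c V2) * Q2) @\<^sub>r
      ((0\<^sub>m r3 r1 @\<^sub>c (U3 @\<^sub>c V3) * Q3) * Q1 @\<^sub>c (0\<^sub>m r3 r2 @\<^sub>c Z) * Q2) @\<^sub>r
      (0\<^sub>m r4 (r1 + (r3 + n1)) @\<^sub>c (0\<^sub>m r4 r2 @\<^sub>c (U4 @\<^sub>c V4) * Q4) * Q2)"
    by (simp add: append_rows_mult add.assoc t row dims D V Z zero_append_cols zero_one_dim del: diag_block_mat.simps)
  also have "\<dots> = ((U1 @\<^sub>c V1) * Q1 @\<^sub>r 0\<^sub>m r2 (r1 + (r3 + n1)) @\<^sub>r (0\<^sub>m r3 r1 @\<^sub>c (U3 @\<^sub>c V3) * Q3) * Q1 @\<^sub>r 0\<^sub>m r4 (r1 + (r3 + n1))) @\<^sub>c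
      (D @\<^sub>r (U2 @\<^sub>c V2) * Q2 @\<^sub>r (0\<^sub>m r3 r2 @\<^sub>c Z) * Q2 @\<^sub>r (0\<^sub>m r4 r2 @\<^sub>c (U4 @\<^sub>c V4) * Q4) * Q2)"
    by (simp add: append_rows_of_append_cols dims d)
  finally show ?thesis .
qed

text \<open>
  The zeros in the top row and in the left column are the reason why \<open>F\<close> and \<open>G\<close> can be
  decomposed independently of each other: only the bottom right quadrant receives contributions from
  all four calls.
\<close>

lemma block_product:
  fixes Y1 :: "'a::semiring_1 mat"
  assumes dims: "dim_row Y1 = k" "dim_row T2 = k" "dim_row E = k'" "dim_row XK = k'" "dim_row Y3 = k'" "dim_row T4 = k'"
    "dim_col Y1 = r1" "dim_col T2 = r2" "dim_col E = r1" "dim_col XK = r2" "dim_col Y3 = r3" "dim_col T4 = r4"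
    "dim_row R1 = r1" "dim_row R3 = r3" "dim_col R1 = h" "dim_col R3 = h"
    "dim_row D = r1" "dim_row R2 = r2" "dim_row Z = r3" "dim_row R4 = r4"
    "dim_col D = h'" "dim_col R2 = h'" "dim_col Z = h'" "dim_col R4 = h'"
  shows "((Y1 @\<^sub>c T2 @\<^sub>c 0\<^sub>m k r3 @\<^sub>c 0\<^sub>m k r4) @\<^sub>r (E @\<^sub>c XK @\<^sub>c Y3 @\<^sub>c T4)) *
     ((R1 @\<^sub>r 0\<^sub>m r2 h @\<^sub>r R3 @\<^sub>r 0\<^sub>m r4 h) @\<^sub>c (D @\<^sub>r R2 @\<^sub>r Z @\<^sub>r R4))
     = (Y1 * R1 @\<^sub>c (Y1 * D + T2 * R2)) @\<^sub>r
       ((E * R1 + Y3 * R3) @\<^sub>c (E * D + (XK * R2 + (Y3 * Z + T4 * R4))))"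
  by (subst append_rows_mult) (simp_all add: block_mult dims)

text \<open>
  Three applications of the two-by-two case, after regrouping the matrix from its lower right
  corner.
\<close>

lemma unit_lower_triangular_assembly:
  assumes dims: "dim_row L1 = r1" "dim_col L1 = r1" "dim_row L2 = r2" "dim_col L2 = r2"
    "dim_row L3 = r3" "dim_col L3 = r3" "dim_row L4 = r4" "dim_col L4 = r4"
    "dim_row M11 = r2" "dim_col M11 = r1"
    "dim_row E1 = r3" "dim_col E1 = r1" "dim_row E21 = r4" "dim_col E21 = r1"
    "dim_row X = r3" "dim_col X = r2" "dim_row K1 = r4" "dim_col K1 = r2"
    "dim_row M31 = r4" "dim_col M31 = r3"
    and L: "unit_lower_triangular L1" "unit_lower_triangular L2" "unit_lower_triangular L3" "unit_lower_triangular L4"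
  shows "unit_lower_triangular
     ((L1 @\<^sub>c 0\<^sub>m r1 r2 @\<^sub>c 0\<^sub>m r1 r3 @\<^sub>c 0\<^sub>m r1 r4) @\<^sub>r
      (M11 @\<^sub>c L2 @\<^sub>c 0\<^sub>m r2 r3 @\<^sub>c 0\<^sub>m r2 r4) @\<^sub>r
      (E1 @\<^sub>c X @\<^sub>c L3 @\<^sub>c 0\<^sub>m r3 r4) @\<^sub>r
      (E21 @\<^sub>c K1 @\<^sub>c M31 @\<^sub>c L4))" (is "unit_lower_triangular ?L")
proof -
  let ?L34 = "(L3 @\<^sub>c 0\<^sub>m r3 r4) @\<^sub>r (M31 @\<^sub>c L4)"
  let ?L234 = "(L2 @\<^sub>c 0\<^sub>m r2 (r3 + r4)) @\<^sub>r ((X @\<^sub>r K1) @\<^sub>c ?L34)"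
  have "?L = (L1 @\<^sub>c 0\<^sub>m r1 (r2 + (r3 + r4))) @\<^sub>r ((M11 @\<^sub>r E1 @\<^sub>r E21) @\<^sub>c ?L234)"
    by (simp add: append_rows_of_append_cols zero_append_cols dims)
  moreover have "unit_lower_triangular ?L34"
    by (rule unit_lower_triangular_append) (simp_all add: L dims)
  then have "unit_lower_triangular ?L234"
    by (intro unit_lower_triangular_append) (simp_all add: L dims)
  then have "unit_lower_triangular ((L1 @\<^sub>c 0\<^sub>m r1 (r2 + (r3 + r4))) @\<^sub>r ((M11 @\<^sub>r E1 @\<^sub>r E21) @\<^sub>c ?L234))"
    by (intro unit_lower_triangular_append) (simp_all add: L dims)
  ultimately show ?thesis by simp
qed

lemma nonsing_upper_triangular_assembly:
  assumes dims: "dim_row U1 = r1" "dim_col U1 = r1" "dim_row U2 = r2" "dim_col U2 = r2"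
    "dim_row U3 = r3" "dim_col U3 = r3" "dim_row U4 = r4" "dim_col U4 = r4"
    "dim_row D1 = r1" "dim_col D1 = r2" "dim_row V11 = r1" "dim_col V11 = r3" "dim_row D21 = r1" "dim_col D21 = r4"
    "dim_row V21 = r2" "dim_col V21 = r4" "dim_row O1 = r3" "dim_col O1 = r4"
    and U: "nonsing_upper_triangular U1" "nonsing_upper_triangular U2" "nonsing_upper_triangular U3" "nonsing_upper_triangular U4"
  shows "nonsing_upper_triangular
     ((U1 @\<^sub>c D1 @\<^sub>c V11 @\<^sub>c D21) @\<^sub>r
      (0\<^sub>m r2 r1 @\<^sub>c U2 @\<^sub>c 0\<^sub>m r2 r3 @\<^sub>c V21) @\<^sub>r
      (0\<^sub>m r3 r1 @\<^sub>c 0\<^sub>m r3 r2 @\<^sub>c U3 @\<^sub>c O1) @\<^sub>r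
      (0\<^sub>m r4 r1 @\<^sub>c 0\<^sub>m r4 r2 @\<^sub>c 0\<^sub>m r4 r3 @\<^sub>c U4))" (is "nonsing_upper_triangular ?U")
proof -
  let ?U34 = "(U3 @\<^sub>c O1) @\<^sub>r (0\<^sub>m r4 r3 @\<^sub>c U4)"
  let ?U234 = "(U2 @\<^sub>c (0\<^sub>m r2 r3 @\<^sub>c V21)) @\<^sub>r (0\<^sub>m (r3 + r4) r2 @\<^sub>c ?U34)"
  have "?U = (U1 @\<^sub>c (D1 @\<^sub>c V11 @\<^sub>c D21)) @\<^sub>r (0\<^sub>m (r2 + (r3 + r4)) r1 @\<^sub>c ?U234)"
    by (simp add: append_rows_of_append_cols zero_append_rows dims)
  moreover have "nonsing_upper_triangular ?U34"
    by (rule nonsing_upper_triangular_append) (simp_all add: U dims)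
  then have "nonsing_upper_triangular ?U234"
    by (intro nonsing_upper_triangular_append) (simp_all add: U dims)
  then have "nonsing_upper_triangular ((U1 @\<^sub>c (D1 @\<^sub>c V11 @\<^sub>c D21)) @\<^sub>r (0\<^sub>m (r2 + (r3 + r4)) r1 @\<^sub>c ?U234))"
    by (intro nonsing_upper_triangular_append) (simp_all add: U dims)
  ultimately show ?thesis by simp
qed

text \<open>
  The hypotheses are the assignments of one recursive step of the algorithm, in its order. The sizes
  of the arguments of the later calls depend on the ranks found by the earlier ones, so that
  dimensions and results are obtained alternately. Then each quadrant
  is an elimination identity: for instance \<open>L\<^sub>1 D = B\<^sub>1\<close> and \<open>M\<^sub>1 D + F = B\<^sub>2\<close>
  give the upper right one, and \<open>X U\<^sub>2 = H\<^sub>1\<close>,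
  \<open>K U\<^sub>2 = H\<^sub>3\<close>, \<open>X V\<^sub>2 + L\<^sub>3 Z = H\<^sub>2\<close> and
  \<open>K V\<^sub>2 + M\<^sub>3 Z + W = H\<^sub>4\<close> recompose \<open>H\<close>.
\<close>

lemma is_PLUQ_step:
  fixes A :: "'a::field mat"
  assumes A: "dim_row A = m" "dim_col A = n" and kh: "0 < k" "k < m" "h < n"
    and IH: "\<And>m' n' (A' :: 'a mat). m' + n' < m + n \<Longrightarrow> dim_row A' = m' \<Longrightarrow> dim_col A' = n' \<Longrightarrow> is_PLUQ m' n' A' (PLUQ m' n' A')"
    and split_A: "split_block A k h = (A1, A2, A3, A4)"
    and run1: "PLUQ k h A1 = (P1, Q1, r1, L1, M1, U1, V1)"
    and split_B: "split_rows r1 (transpose_mat P1 * A2) = (B1, B2)"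
    and split_C: "split_cols r1 (A3 * transpose_mat Q1) = (C1, C2)"
    and D: "D = mat_inv L1 * B1"
    and E: "E = C1 * mat_inv U1"
    and F: "F = B2 - M1 * D"
    and G: "G = C2 - E * V1"
    and H: "H = A4 - E * D"
    and run2: "PLUQ (k - r1) (n - h) F = (P2, Q2, r2, L2, M2, U2, V2)"
    and run3: "PLUQ (m - k) (h - r1) G = (P3, Q3, r3, L3, M3, U3, V3)"
    and split_H: "split_block (transpose_mat P3 * H * transpose_mat Q2) r3 r2 = (H1, H2, H3, H4)"
    and split_E: "split_rows r3 (transpose_mat P3 * E) = (E1, E2)"
    and split_M1: "split_rows r2 (transpose_mat P2 * M1) = (M11, M12)"
    and split_D: "split_cols r2 (D * transpose_mat Q2) = (D1, D2)"
    and split_V1: "split_cols r3 (V1 * transpose_mat Q3) = (V11, V12)"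
    and X: "X = H1 * mat_inv U2"
    and J: "J = mat_inv L3 * X"
    and K: "K = H3 * mat_inv U2"
    and N: "N = mat_inv L3 * H2"
    and Z: "Z = N - J * V2"
    and W: "W = H4 - K * V2 - M3 * Z"
    and run4: "PLUQ (m - k - r3) (n - h - r2) W = (P4, Q4, r4, L4, M4, U4, V4)"
    and split_E2: "split_rows r4 (transpose_mat P4 * E2) = (E21, E22)"
    and split_M3: "split_rows r4 (transpose_mat P4 * M3) = (M31, M32)"
    and split_K: "split_rows r4 (transpose_mat P4 * K) = (K1, K2)"
    and split_D2: "split_cols r4 (D2 * transpose_mat Q4) = (D21, D22)"
    and split_V2: "split_cols r4 (V2 * transpose_mat Q4) = (V21, V22)"
    and split_Z: "split_cols r4 (Z * transpose_mat Q4) = (O1, O2)"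
    and m1: "m1 = k - r1 - r2" and m2: "m2 = m - k - r3 - r4"
    and n1: "n1 = h - r1 - r3" and n2: "n2 = n - h - r2 - r4"
  shows "is_PLUQ m n A
    (diag_block_mat [P1 * diag_block_mat [1\<^sub>m r1, P2], P3 * diag_block_mat [1\<^sub>m r3, P4]] *
       row_block_perm (r1 + r2) (r3 + r4) m1 m2,
     col_block_perm r1 r2 r3 r4 n1 n2 *
       diag_block_mat [diag_block_mat [1\<^sub>m r1, Q3] * Q1, diag_block_mat [1\<^sub>m r2, Q4] * Q2],
     r1 + r2 + r3 + r4,
     (L1 @\<^sub>c 0\<^sub>m r1 r2 @\<^sub>c 0\<^sub>m r1 r3 @\<^sub>c 0\<^sub>m r1 r4) @\<^sub>r
     (M11 @\<^sub>c L2 @\<^sub>c 0\<^sub>m r2 r3 @\<^sub>c 0\<^sub>m r2 r4) @\<^sub>r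
     (E1 @\<^sub>c X @\<^sub>c L3 @\<^sub>c 0\<^sub>m r3 r4) @\<^sub>r
     (E21 @\<^sub>c K1 @\<^sub>c M31 @\<^sub>c L4),
     (M12 @\<^sub>c M2 @\<^sub>c 0\<^sub>m m1 r3 @\<^sub>c 0\<^sub>m m1 r4) @\<^sub>r
     (E22 @\<^sub>c K2 @\<^sub>c M32 @\<^sub>c M4),
     (U1 @\<^sub>c D1 @\<^sub>c V11 @\<^sub>c D21) @\<^sub>r
     (0\<^sub>m r2 r1 @\<^sub>c U2 @\<^sub>c 0\<^sub>m r2 r3 @\<^sub>c V21) @\<^sub>r
     (0\<^sub>m r3 r1 @\<^sub>c 0\<^sub>m r3 r2 @\<^sub>c U3 @\<^sub>c O1) @\<^sub>r
     (0\<^sub>m r4 r1 @\<^sub>c 0\<^sub>m r4 r2 @\<^sub>c 0\<^sub>m r4 r3 @\<^sub>c U4),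
     (V12 @\<^sub>c D22) @\<^sub>r
     (0\<^sub>m r2 n1 @\<^sub>c V22) @\<^sub>r
     (V3 @\<^sub>c O2) @\<^sub>r
     (0\<^sub>m r4 n1 @\<^sub>c V4))"
    (is "is_PLUQ m n A (?P, ?Q, ?r, ?L, ?M, ?U, ?V)")
proof -
  have Akh: "dim_row A = k + (m - k)" "dim_col A = h + (n - h)"
    using A kh by linarith+
  note a = split_block_eq[OF split_A Akh]
  have "is_PLUQ k h A1 (P1, Q1, r1, L1, M1, U1, V1)"
    unfolding run1[symmetric] by (rule IH) (use kh a(2,6) in linarith)+
  note d1 = is_PLUQD[OF this]
  note p1 = permutation_matE[OF d1(1)] and q1 = permutation_matE[OF d1(2)]
  note l1 = mat_inv_unit_lower_triangular[OF d1(7,5,6)]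
  note u1 = mat_inv_nonsing_upper_triangular[OF d1(12,10,11)]
  have kr: "r1 + (k - r1) = k" "r1 + (h - r1) = h" using d1(3,4) by simp_all
  note dims1 = a(2-9) p1(1,2) q1(1,2) d1(5,6,8-11,13,14) l1(3,4) u1(3,4)
  have "dim_row (transpose_mat P1 * A2) = r1 + (k - r1)" by (simp add: dims1 kr)
  note b = split_rows_eq[OF split_B this]
  have "dim_col (A3 * transpose_mat Q1) = r1 + (h - r1)" by (simp add: dims1 kr)
  note c = split_cols_eq[OF split_C this]
  have "dim_col B1 = n - h" "dim_col B2 = n - h" "dim_row C1 = m - k" "dim_row C2 = m - k"
    by (simp_all add: b(4,5) c(4,5) dims1)
  note dims2 = dims1 b(2,3) c(2,3) this
  have "dim_row D = r1" "dim_col D = n - h" "dim_row E = m - k" "dim_col E = r1"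
    "dim_row F = k - r1" "dim_col F = n - h" "dim_row G = m - k" "dim_col G = h - r1"
    "dim_row H = m - k" "dim_col H = n - h"
    by (simp_all add: D E F G H dims2)
  note dims3 = dims2 this

  have "is_PLUQ (k - r1) (n - h) F (P2, Q2, r2, L2, M2, U2, V2)"
    unfolding run2[symmetric] by (rule IH) (use kh in \<open>simp_all add: dims3\<close>)
  note d2 = is_PLUQD[OF this]
  note p2 = permutation_matE[OF d2(1)] and q2 = permutation_matE[OF d2(2)]
  note u2 = mat_inv_nonsing_upper_triangular[OF d2(12,10,11)]
  have "is_PLUQ (m - k) (h - r1) G (P3, Q3, r3, L3, M3, U3, V3)"
    unfolding run3[symmetric] by (rule IH) (use kh in \<open>simp_all add: dims3\<close>)
  note d3 = is_PLUQD[OF this]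
  note p3 = permutation_matE[OF d3(1)] and q3 = permutation_matE[OF d3(2)]
  note l3 = mat_inv_unit_lower_triangular[OF d3(7,5,6)]

  note dims4 = dims3 p2(1,2) q2(1,2) p3(1,2) q3(1,2) d2(5,6,8-11,13,14) d3(5,6,8-11,13,14) u2(3,4) l3(3,4)
  have kr': "r3 + (m - k - r3) = m - k" "r2 + (n - h - r2) = n - h" "k + (m - k) = m" "h + (n - h) = n"
    using d3(3) d2(4) kh by simp_all
  have "dim_row (transpose_mat P3 * H * transpose_mat Q2) = r3 + (m - k - r3)"
    "dim_col (transpose_mat P3 * H * transpose_mat Q2) = r2 + (n - h - r2)"
    using d3(3) d2(4) by (simp_all add: dims4)
  note h = split_block_eq[OF split_H this]
  have "dim_row X = r3" "dim_col X = r2" "dim_row J = r3" "dim_col J = r2"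
    "dim_row K = m - k - r3" "dim_col K = r2" "dim_row N = r3" "dim_col N = n - h - r2"
    "dim_row Z = r3" "dim_col Z = n - h - r2" "dim_row W = m - k - r3" "dim_col W = n - h - r2"
    by (simp_all add: X J K N Z W dims4 h(2-9))
  note dims5 = dims4 h(2-9) this
  have "is_PLUQ (m - k - r3) (n - h - r2) W (P4, Q4, r4, L4, M4, U4, V4)"
    unfolding run4[symmetric] by (rule IH) (use kh in \<open>simp_all add: dims5\<close>)
  note d4 = is_PLUQD[OF this]
  note p4 = permutation_matE[OF d4(1)] and q4 = permutation_matE[OF d4(2)]

  \<comment> \<open>From here on all sizes are sums of block sizes, so that differences such as \<open>k - r1\<close> cancel
    and the dimension side conditions are closed by simplification.\<close>
  have "k = r1 + (r2 + m1)" "h = r1 + (r3 + n1)"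
    using d1(3) d2(3) m1 d1(4) d3(4) n1 by linarith+
  moreover have "m - k = r3 + (r4 + m2)" "n - h = r2 + (r4 + n2)"
    using d3(3) d4(3) m2 d2(4) d4(4) n2 by linarith+
  moreover from this have "m = k + (r3 + (r4 + m2))" "n = h + (r2 + (r4 + n2))"
    using kh(2,3) by linarith+
  ultimately have sizes: "k = r1 + (r2 + m1)" "h = r1 + (r3 + n1)"
    "m - k = r3 + (r4 + m2)" "n - h = r2 + (r4 + n2)"
    "m = (r1 + (r2 + m1)) + (r3 + (r4 + m2))" "n = (r1 + (r3 + n1)) + (r2 + (r4 + n2))"
    by linarith+
  note dims6 = dims5 p4(1,2) q4(1,2) d4(5,6,8-11,13,14) sizes
  have "dim_row (transpose_mat P3 * E) = r3 + (r4 + m2)" "dim_row (transpose_mat P2 * M1) = r2 + m1"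
    "dim_col (D * transpose_mat Q2) = r2 + (r4 + n2)" "dim_col (V1 * transpose_mat Q3) = r3 + n1"
    by (simp_all add: dims6)
  note e = split_rows_eq[OF split_E this(1)] and m = split_rows_eq[OF split_M1 this(2)]
    and d = split_cols_eq[OF split_D this(3)] and v = split_cols_eq[OF split_V1 this(4)]
  note dims7 = dims6 e(2-5) m(2-5) d(2-5) v(2-5)
  have "dim_row (transpose_mat P4 * E2) = r4 + m2" "dim_row (transpose_mat P4 * M3) = r4 + m2"
    "dim_row (transpose_mat P4 * K) = r4 + m2" "dim_col (D2 * transpose_mat Q4) = r4 + n2"
    "dim_col (V2 * transpose_mat Q4) = r4 + n2" "dim_col (Z * transpose_mat Q4) = r4 + n2"
    by (simp_all add: dims7)
  note e2 = split_rows_eq[OF split_E2 this(1)] and m3 = split_rows_eq[OF split_M3 this(2)]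
    and k = split_rows_eq[OF split_K this(3)] and d2' = split_cols_eq[OF split_D2 this(4)]
    and v2 = split_cols_eq[OF split_V2 this(5)] and z = split_cols_eq[OF split_Z this(6)]
  note dims = dims7 e2(2-5) m3(2-5) k(2-5) d2'(2-5) v2(2-5) z(2-5)

  \<comment> \<open>Each block was split after multiplication by a transposed permutation matrix; multiplying back
    recovers it.\<close>
  have A2: "P1 * (B1 @\<^sub>r B2) = A2" by (rule mult_transpose_cancel[OF d1(1) b(1)]) (simp add: dims)
  have A3: "(C1 @\<^sub>c C2) * Q1 = A3" by (rule transpose_mult_cancel[OF d1(2) c(1)]) (simp add: dims)
  have E': "P3 * (E1 @\<^sub>r E2) = E" by (rule mult_transpose_cancel[OF d3(1) e(1)]) (simp add: dims)
  have M1': "P2 * (M11 @\<^sub>r M12) = M1" by (rule mult_transpose_cancel[OF d2(1) m(1)]) (simp add: dims)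
  have D': "(D1 @\<^sub>c D2) * Q2 = D" by (rule transpose_mult_cancel[OF d2(2) d(1)]) (simp add: dims)
  have V1': "(V11 @\<^sub>c V12) * Q3 = V1" by (rule transpose_mult_cancel[OF d3(2) v(1)]) (simp add: dims)
  have E2': "P4 * (E21 @\<^sub>r E22) = E2" by (rule mult_transpose_cancel[OF d4(1) e2(1)]) (simp add: dims)
  have M3': "P4 * (M31 @\<^sub>r M32) = M3" by (rule mult_transpose_cancel[OF d4(1) m3(1)]) (simp add: dims)
  have K': "P4 * (K1 @\<^sub>r K2) = K" by (rule mult_transpose_cancel[OF d4(1) k(1)]) (simp add: dims)
  have D2': "(D21 @\<^sub>c D22) * Q4 = D2" by (rule transpose_mult_cancel[OF d4(2) d2'(1)]) (simp add: dims)
  have V2': "(V21 @\<^sub>c V22) * Q4 = V2" by (rule transpose_mult_cancel[OF d4(2) v2(1)]) (simp add: dims)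
  have Z': "(O1 @\<^sub>c O2) * Q4 = Z" by (rule transpose_mult_cancel[OF d4(2) z(1)]) (simp add: dims)
  have H': "P3 * ((H1 @\<^sub>c H2) @\<^sub>r (H3 @\<^sub>c H4)) * Q2 = H"
  proof -
    have "(transpose_mat P3 * H) * transpose_mat Q2 = (H1 @\<^sub>c H2) @\<^sub>r (H3 @\<^sub>c H4)" by (rule h(1))
    from transpose_mult_cancel[OF d2(2) this]
    have "((H1 @\<^sub>c H2) @\<^sub>r (H3 @\<^sub>c H4)) * Q2 = transpose_mat P3 * H" by (simp add: dims)
    from mult_transpose_cancel[OF d3(1) this[symmetric]] show ?thesis
      by (simp add: dims assoc_mult_dim)
  qed

  define Y1 Y2 Y3 Y4 where "Y1 = P1 * (L1 @\<^sub>r M1)" and "Y2 = P2 * (L2 @\<^sub>r M2)"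
    and "Y3 = P3 * (L3 @\<^sub>r M3)" and "Y4 = P4 * (L4 @\<^sub>r M4)"
  note Y = this
  define R1 R2 R3 R4 where "R1 = (U1 @\<^sub>c V1) * Q1" and "R2 = (U2 @\<^sub>c V2) * Q2"
    and "R3 = (U3 @\<^sub>c V3) * Q3" and "R4 = (U4 @\<^sub>c V4) * Q4"
  note R = this
  have YR: "Y1 * R1 = A1" "Y2 * R2 = F" "Y3 * R3 = G" "Y4 * R4 = W"
    by (simp_all only: Y R d1(15) d2(15) d3(15) d4(15))
  have "dim_row Y1 = k" "dim_col Y1 = r1" "dim_row Y2 = r2 + m1" "dim_col Y2 = r2"
    "dim_row Y3 = m - k" "dim_col Y3 = r3" "dim_row Y4 = r4 + m2" "dim_col Y4 = r4"
    "dim_row R1 = r1" "dim_col R1 = h" "dim_row R2 = r2" "dim_col R2 = n - h"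
    "dim_row R3 = r3" "dim_col R3 = r3 + n1" "dim_row R4 = r4" "dim_col R4 = r4 + n2"
    by (simp_all add: Y R dims)
  note dimsYR = dims this

  have left: "?P * (?L @\<^sub>r ?M) =
      (Y1 @\<^sub>c P1 * (0\<^sub>m r1 r2 @\<^sub>r Y2) @\<^sub>c 0\<^sub>m (r1 + (r2 + m1)) r3 @\<^sub>c 0\<^sub>m (r1 + (r2 + m1)) r4) @\<^sub>r
      (E @\<^sub>c P3 * (X @\<^sub>r K) @\<^sub>c Y3 @\<^sub>c P3 * (0\<^sub>m r3 r4 @\<^sub>r Y4))"
    unfolding Y
    by (simp add: left_factor[where r = "r1 + (r2 + (r3 + r4))"] left_factor_top[where ?M1.0 = M1]
        left_factor_bottom[where ?E2.0 = E2 and E = E and K = K and ?M3.0 = M3] dims E' M1' E2' M3' K'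
        del: diag_block_mat.simps)
  have right: "(?U @\<^sub>c ?V) * ?Q =
      (R1 @\<^sub>r 0\<^sub>m r2 (r1 + (r3 + n1)) @\<^sub>r (0\<^sub>m r3 r1 @\<^sub>c R3) * Q1 @\<^sub>r 0\<^sub>m r4 (r1 + (r3 + n1))) @\<^sub>c
      (D @\<^sub>r R2 @\<^sub>r (0\<^sub>m r3 r2 @\<^sub>c Z) * Q2 @\<^sub>r (0\<^sub>m r4 r2 @\<^sub>c R4) * Q2)"
    unfolding R by (rule right_factor[where ?D2.0 = D2]) (simp_all add: dims D' V1' D2' V2' Z')

  have blk2: "Y1 * D + P1 * (0\<^sub>m r1 r2 @\<^sub>r Y2) * R2 = A2"
  proof -
    have "L1 * D = B1"
      by (simp add: D dims l1(1) one_mult_dim flip: assoc_mult_dim)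
    then have "(L1 @\<^sub>r M1) * D + (0\<^sub>m r1 r2 @\<^sub>r Y2) * R2 = B1 @\<^sub>r B2"
      by (simp add: dimsYR append_rows_mult append_rows_add zero_one_dim YR F add_diff_dim)
    then have "A2 = P1 * ((L1 @\<^sub>r M1) * D + (0\<^sub>m r1 r2 @\<^sub>r Y2) * R2)"
      by (simp add: A2)
    also have "\<dots> = Y1 * D + P1 * (0\<^sub>m r1 r2 @\<^sub>r Y2) * R2"
      unfolding Y(1) by (simp add: mult_add_dim assoc_mult_dim dimsYR)
    finally show ?thesis by simp
  qed
  have blk3: "E * R1 + Y3 * ((0\<^sub>m r3 r1 @\<^sub>c R3) * Q1) = A3"
  proof -
    have "E * U1 = C1"
      by (simp add: E dims assoc_mult_dim u1(2) mult_one_dim)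
    then have "E * (U1 @\<^sub>c V1) + Y3 * (0\<^sub>m r3 r1 @\<^sub>c R3) = C1 @\<^sub>c C2"
      by (simp add: dimsYR mult_append_cols append_cols_add zero_one_dim YR G add_diff_dim)
    then have "A3 = (E * (U1 @\<^sub>c V1) + Y3 * (0\<^sub>m r3 r1 @\<^sub>c R3)) * Q1"
      by (simp add: A3)
    also have "\<dots> = E * R1 + Y3 * ((0\<^sub>m r3 r1 @\<^sub>c R3) * Q1)"
      unfolding R(1) by (simp add: add_mult_dim assoc_mult_dim dimsYR)
    finally show ?thesis by simp
  qed
  have blk4: "E * D + (P3 * (X @\<^sub>r K) * R2 +
      (Y3 * ((0\<^sub>m r3 r2 @\<^sub>c Z) * Q2) + P3 * (0\<^sub>m r3 r4 @\<^sub>r Y4) * ((0\<^sub>m r4 r2 @\<^sub>c R4) * Q2))) = A4"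
  proof -
    have XU: "X * U2 = H1" "K * U2 = H3"
      by (simp_all add: X K dims assoc_mult_dim u2(2) mult_one_dim)
    have "L3 * J = X" "L3 * N = H2"
      by (simp_all add: J N dims l3(1) one_mult_dim flip: assoc_mult_dim)
    then have LZ: "L3 * Z = H2 - X * V2"
      by (simp add: Z dims mult_minus_dim flip: assoc_mult_dim)
    have "(X @\<^sub>r K) * (U2 @\<^sub>c V2) + ((L3 @\<^sub>r M3) * (0\<^sub>m r3 r2 @\<^sub>c Z) + (0\<^sub>m r3 r4 @\<^sub>r Y4) * (0\<^sub>m r4 r2 @\<^sub>c R4))
        = (H1 @\<^sub>c H2) @\<^sub>r (H3 @\<^sub>c H4)" (is "?X + (?LZ + ?YR) = _")
    proof -
      have "?X = (H1 @\<^sub>c X * V2) @\<^sub>r (H3 @\<^sub>c K * V2)"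
        by (subst append_rows_mult) (simp_all add: mult_append_cols dims XU)
      moreover have "?LZ = (0\<^sub>m r3 r2 @\<^sub>c (H2 - X * V2)) @\<^sub>r (0\<^sub>m (r4 + m2) r2 @\<^sub>c M3 * Z)"
        by (subst append_rows_mult) (simp_all add: mult_append_cols dims LZ zero_one_dim)
      moreover have "?YR = (0\<^sub>m r3 r2 @\<^sub>c 0\<^sub>m r3 (r4 + n2)) @\<^sub>r (0\<^sub>m (r4 + m2) r2 @\<^sub>c W)"
        by (subst append_rows_mult) (simp_all add: mult_append_cols dimsYR YR zero_one_dim)
      ultimately show ?thesis
        by (simp add: append_rows_add append_cols_add dims zero_one_dim add_diff_dim W add_add_diff_dim)
    qed
    then have "H = P3 * (?X + (?LZ + ?YR)) * Q2"
      by (simp add: H')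
    also have "\<dots> = P3 * (X @\<^sub>r K) * R2 +
      (Y3 * ((0\<^sub>m r3 r2 @\<^sub>c Z) * Q2) + P3 * (0\<^sub>m r3 r4 @\<^sub>r Y4) * ((0\<^sub>m r4 r2 @\<^sub>c R4) * Q2))"
      unfolding Y(3) R(2)
      by (simp add: mult_add_dim add_mult_dim assoc_mult_dim dimsYR)
    finally have "E * D + (P3 * (X @\<^sub>r K) * R2 +
      (Y3 * ((0\<^sub>m r3 r2 @\<^sub>c Z) * Q2) + P3 * (0\<^sub>m r3 r4 @\<^sub>r Y4) * ((0\<^sub>m r4 r2 @\<^sub>c R4) * Q2))) = E * D + H"
      by simp
    also have "\<dots> = A4" unfolding H by (simp add: add_diff_dim dims)
    finally show ?thesis .
  qed
  have "A = (?P * (?L @\<^sub>r ?M)) * ((?U @\<^sub>c ?V) * ?Q)"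
    unfolding left right
    by (subst block_product[where k' = "r3 + (r4 + m2)" and h' = "r2 + (r4 + n2)"])
      (simp_all add: dimsYR blk2 blk3 blk4 YR a(1))
  moreover have "permutation_mat m ?P"
  proof (rule permutation_mat_mult)
    show "permutation_mat m (row_block_perm (r1 + r2) (r3 + r4) m1 m2 :: 'a mat)"
      using permutation_mat_row_block_perm[of "r1 + r2" "r3 + r4" m1 m2] by (simp add: sizes(5) add_ac)
    have "permutation_mat k (diag_block_mat [1\<^sub>m r1, P2])"
      using permutation_mat_diag[OF permutation_mat_one d2(1), of r1] by (simp only: kr)
    moreover have "permutation_mat (m - k) (diag_block_mat [1\<^sub>m r3, P4])"
      using permutation_mat_diag[OF permutation_mat_one d4(1), of r3] by (simp only: kr')
    ultimately show "permutation_mat m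
        (diag_block_mat [P1 * diag_block_mat [1\<^sub>m r1, P2], P3 * diag_block_mat [1\<^sub>m r3, P4]])"
      using permutation_mat_diag[OF permutation_mat_mult permutation_mat_mult] d1(1) d3(1) kr'(3) by metis
  qed
  moreover have "permutation_mat n ?Q"
  proof (rule permutation_mat_mult)
    show "permutation_mat n (col_block_perm r1 r2 r3 r4 n1 n2 :: 'a mat)"
      using permutation_mat_col_block_perm[of r1 r2 r3 r4 n1 n2] by (simp add: sizes(6) add_ac)
    have "permutation_mat h (diag_block_mat [1\<^sub>m r1, Q3])"
      using permutation_mat_diag[OF permutation_mat_one d3(2), of r1] by (simp only: kr)
    moreover have "permutation_mat (n - h) (diag_block_mat [1\<^sub>m r2, Q4])"
      using permutation_mat_diag[OF permutation_mat_one d4(2), of r2] by (simp only: kr')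
    ultimately show "permutation_mat n
        (diag_block_mat [diag_block_mat [1\<^sub>m r1, Q3] * Q1, diag_block_mat [1\<^sub>m r2, Q4] * Q2])"
      using permutation_mat_diag[OF permutation_mat_mult permutation_mat_mult] d1(2) d2(2) kr'(4) by metis
  qed
  moreover have "unit_lower_triangular ?L"
    by (rule unit_lower_triangular_assembly) (simp_all add: dims d1(7) d2(7) d3(7) d4(7))
  moreover have "nonsing_upper_triangular ?U"
    by (rule nonsing_upper_triangular_assembly) (simp_all add: dims d1(12) d2(12) d3(12) d4(12))
  ultimately show ?thesis
    unfolding is_PLUQ_def by (simp add: dims sizes(5,6))
qed

section \<open>Base cases\<close>

text \<open>
  Covers empty matrices as well, since these are zero matrices.
\<close>

lemma is_PLUQ_zero:
  "is_PLUQ m n (0\<^sub>m m n :: 'a::field mat) (1\<^sub>m m, 1\<^sub>m n, 0, 0\<^sub>m 0 0, 0\<^sub>m m 0, 0\<^sub>m 0 0, 0\<^sub>m 0 n)"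
proof -
  have "unit_lower_triangular (0\<^sub>m 0 0 :: 'a mat)" "nonsing_upper_triangular (0\<^sub>m 0 0 :: 'a mat)"
    by (simp_all add: unit_lower_triangular_def nonsing_upper_triangular_def upper_triangular_def)
  then show ?thesis
    by (simp add: is_PLUQ_def permutation_mat_one zero_append_rows zero_append_cols zero_one_dim)
qed

lemma is_PLUQ_row:
  fixes A :: "'a::field mat"
  assumes A: "dim_row A = 1" "dim_col A = n" "A \<noteq> 0\<^sub>m 1 n"
    and i: "i = (LEAST j. j < n \<and> A $$ (0, j) \<noteq> 0)"
    and split: "split_cols 1 (A * swaprows_mat n 0 i) = (U, V)"
  shows "is_PLUQ 1 n A (1\<^sub>m 1, swaprows_mat n 0 i, 1, 1\<^sub>m 1, 0\<^sub>m 0 1, U, V)"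
proof -
  have "\<exists>j. j < n \<and> A $$ (0, j) \<noteq> 0"
    using A by (auto simp: mat_eq_iff)
  from LeastI_ex[OF this] have i: "i < n" "A $$ (0, i) \<noteq> 0" unfolding i by auto
  then have "dim_col (A * swaprows_mat n 0 i) = 1 + (n - 1)" by simp
  note s = split_cols_eq[OF split this]
  have "(A * swaprows_mat n 0 i) $$ (0, 0) = (\<Sum>k = 0..<n. A $$ (0, k) * (if k = i then 1 else 0))"
    using A i by (auto simp: scalar_prod_def intro!: sum.cong)
  also have "\<dots> = A $$ (0, i)"
    using i(1) by (subst sum.cong[OF refl, of _ _ "\<lambda>k. if k = i then A $$ (0, k) else 0"]) auto
  finally have "(U @\<^sub>c V) $$ (0, 0) = A $$ (0, i)"
    by (simp only: s(1))
  then have "U $$ (0, 0) \<noteq> 0"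
    using s(2,4) A(1) i(2) by (simp add: index_append_cols)
  then have "nonsing_upper_triangular U"
    using A s(4) by (simp add: nonsing_upper_triangular_def upper_triangular_def)
  moreover have "unit_lower_triangular (1\<^sub>m 1 :: 'a mat)"
    by (simp add: unit_lower_triangular_def)
  moreover have eq: "A = (1\<^sub>m 1 * (1\<^sub>m 1 @\<^sub>r 0\<^sub>m 0 1)) * ((U @\<^sub>c V) * swaprows_mat n 0 i)"
  proof -
    have "(1\<^sub>m 1 @\<^sub>r 0\<^sub>m 0 1 :: 'a mat) = 1\<^sub>m 1" by (intro eq_matI) (auto simp: index_append_rows)
    moreover have "(A * swaprows_mat n 0 i) * swaprows_mat n 0 i = A"
      using A i by (simp add: assoc_mult_dim swaprows_mat_inv mult_one_dim)
    ultimately show ?thesis using A by (simp add: one_mult_dim flip: s(1))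
  qed
  ultimately show ?thesis
    unfolding is_PLUQ_def prod.case using i(1)
    by (intro conjI eq) (simp_all add: s(2-5) A permutation_mat_one permutation_mat_swaprows)
qed

lemma is_PLUQ_col:
  fixes A :: "'a::field mat"
  assumes A: "dim_row A = m" "dim_col A = 1" "A \<noteq> 0\<^sub>m m 1"
    and i: "i = (LEAST j. j < m \<and> A $$ (j, 0) \<noteq> 0)" and a: "a = A $$ (i, 0)"
    and split: "split_rows 1 (inverse a \<cdot>\<^sub>m (swaprows_mat m 0 i * A)) = (L, M)"
  shows "is_PLUQ m 1 A (swaprows_mat m 0 i, 1\<^sub>m 1, 1, L, M, mat 1 1 (\<lambda>_. a), 0\<^sub>m 1 0)"
proof -
  have "\<exists>j. j < m \<and> A $$ (j, 0) \<noteq> 0"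
    using A by (auto simp: mat_eq_iff)
  from LeastI_ex[OF this] have i: "i < m" "A $$ (i, 0) \<noteq> 0" unfolding i by auto
  then have "dim_row (inverse a \<cdot>\<^sub>m (swaprows_mat m 0 i * A)) = 1 + (m - 1)" by simp
  note s = split_rows_eq[OF split this]
  have "(swaprows_mat m 0 i * A) $$ (0, 0) = (\<Sum>k = 0..<m. (if k = i then 1 else 0) * A $$ (k, 0))"
    using A i by (auto simp: scalar_prod_def intro!: sum.cong)
  also have "\<dots> = a"
    using i a by (simp add: if_distrib[where f = "\<lambda>x. x * y" for y] cong: if_cong)
  \<comment> \<open>Scaling by the inverse of the pivot makes the leading entry one.\<close>
  finally have "(L @\<^sub>r M) $$ (0, 0) = 1"
    using A i a by (simp flip: s(1))
  then have "L $$ (0, 0) = 1"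
    using A s(2-5) by (simp add: index_append_rows)
  then have "unit_lower_triangular L"
    using A s(2,4) by (simp add: unit_lower_triangular_def)
  moreover have "nonsing_upper_triangular (mat 1 1 (\<lambda>_. a))"
    using i a by (simp add: nonsing_upper_triangular_def upper_triangular_def)
  moreover have eq: "A = (swaprows_mat m 0 i * (L @\<^sub>r M)) * ((mat 1 1 (\<lambda>_. a) @\<^sub>c 0\<^sub>m 1 0) * 1\<^sub>m 1)"
  proof -
    have "(mat 1 1 (\<lambda>_. a) @\<^sub>c 0\<^sub>m 1 0) = mat 1 1 (\<lambda>_. a)"
      by (intro eq_matI) (auto simp: index_append_cols)
    moreover have "swaprows_mat m 0 i * (swaprows_mat m 0 i * A) = A"
      using A i by (simp add: swaprows_mat_inv one_mult_dim flip: assoc_mult_dim)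
    then have "swaprows_mat m 0 i * (inverse a \<cdot>\<^sub>m (swaprows_mat m 0 i * A)) = inverse a \<cdot>\<^sub>m A"
      using A by (subst mult_smult_distrib[where nr = m and n = m and nc = 1]) (auto intro!: carrier_matI)
    moreover have "inverse a \<cdot>\<^sub>m A * mat 1 1 (\<lambda>_. a) = A"
      using A i a by (intro eq_matI) (auto simp: scalar_prod_def)
    ultimately show ?thesis using A by (simp add: mult_one_dim flip: s(1))
  qed
  ultimately show ?thesis
    unfolding is_PLUQ_def prod.case using i(1)
    by (intro conjI eq) (simp_all add: s(2-5) A permutation_mat_one permutation_mat_swaprows)
qed

section \<open>Correctness of the algorithm\<close>

text \<open>
  These rules turn the local bindings of the algorithm into the hypotheses of \<open>is_PLUQ_step\<close>.
  Unfolding the bindings instead would copy each intermediate matrix into every later one.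
\<close>

lemma let_tuple_intros:
  "(\<And>x. x = t \<Longrightarrow> R (f1 x)) \<Longrightarrow> R (let x = t in f1 x)"
  "(\<And>a b. t2 = (a, b) \<Longrightarrow> R (f2 a b)) \<Longrightarrow> R (let (a, b) = t2 in f2 a b)"
  "(\<And>a b c d. t4 = (a, b, c, d) \<Longrightarrow> R (f4 a b c d)) \<Longrightarrow> R (let (a, b, c, d) = t4 in f4 a b c d)"
  "(\<And>a b c d e f g. t7 = (a, b, c, d, e, f, g) \<Longrightarrow> R (f7 a b c d e f g)) \<Longrightarrow>
     R (let (a, b, c, d, e, f, g) = t7 in f7 a b c d e f g)"
  by (simp, cases t2, simp, cases t4, simp, cases t7, simp)

text \<open>
  Induction on the sum of the dimensions, by which every recursive call is smaller: each of the four
  arguments omits at least the upper or the lower half of the rows, or the left or the right half of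
  the columns.
\<close>

theorem PLUQ_correct:
  fixes A :: "'a::field mat"
  assumes "dim_row A = m" "dim_col A = n"
  shows "is_PLUQ m n A (PLUQ m n A)"
  using assms
proof (induction "m + n" arbitrary: m n A rule: less_induct)
  case (less m n A)
  note A = less.prems
  note intros = let_tuple_intros(4,3,2,1)[where R = "is_PLUQ m n A"]
  consider "m = 0 \<or> n = 0" | "m = 1" "n \<noteq> 0" | "n = 1" "m \<noteq> 0" "m \<noteq> 1" | "2 \<le> m" "2 \<le> n" by linarith
  then show ?case
  proof cases
    case 1
    with A have "A = 0\<^sub>m m n" by (intro eq_matI) auto
    with 1 is_PLUQ_zero[of m n] show ?thesis by (subst PLUQ.simps) simp
  next
    case 2
    show ?thesis
    proof (cases "A = 0\<^sub>m m n")
      case True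
      with 2 is_PLUQ_zero[of m n] show ?thesis by (subst PLUQ.simps) simp
    next
      case False
      have "is_PLUQ m n A (let i = (LEAST j. j < n \<and> A $$ (0, j) \<noteq> 0);
              (U, V) = split_cols 1 (A * swaprows_mat n 0 i)
          in (1\<^sub>m 1, swaprows_mat n 0 i, 1, 1\<^sub>m 1, 0\<^sub>m 0 1, U, V))"
        unfolding 2 by (intro intros[unfolded 2] is_PLUQ_row) (use False 2 A in auto)
      with 2 False show ?thesis by (subst PLUQ.simps) simp
    qed
  next
    case 3
    show ?thesis
    proof (cases "A = 0\<^sub>m m n")
      case True
      with 3 is_PLUQ_zero[of m n] show ?thesis by (subst PLUQ.simps) simp
    next
      case False
      have "is_PLUQ m n A (let i = (LEAST j. j < m \<and> A $$ (j, 0) \<noteq> 0);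
              a = A $$ (i, 0);
              (L, M) = split_rows 1 (inverse a \<cdot>\<^sub>m (swaprows_mat m 0 i * A))
          in (swaprows_mat m 0 i, 1\<^sub>m 1, 1, L, M, mat 1 1 (\<lambda>_. a), 0\<^sub>m 1 0))"
        unfolding 3 by (intro intros[unfolded 3] is_PLUQ_col) (use False 3 A in auto)
      with 3 False show ?thesis by (subst PLUQ.simps) simp
    qed
  next
    case 4
    then have c: "(m = 0 \<or> n = 0) = False" "(m = 1) = False" "(n = 1) = False" by auto
    show ?thesis
      apply (subst PLUQ.simps)
      apply (simp only: c if_False)
      apply (rule intros)+
      \<comment> \<open>The bindings \<open>p(3-35)\<close> are the steps up to the sizes of the blocks of \<open>S\<close> and \<open>T\<close>;
        \<open>p(36-43)\<close> bind \<open>S\<close>, \<open>T\<close> and the six matrices of the result, and are substituted.\<close>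
      subgoal premises p
        unfolding p(36-43) row_block_perm_def[symmetric] col_block_perm_def[symmetric]
        by (rule is_PLUQ_step[OF A _ _ _ less.hyps p(3-35)]) (use 4 p(1,2) in auto)
      done
  qed
qed

theorem mainTheorem1:
  fixes A :: "'a::field mat" and m n :: nat
  assumes "A \<in> carrier_mat m n"
  shows "let (P, Q, r, L, M, U, V) = PLUQ m n A in
      permutation_mat m P \<and>
      permutation_mat n Q \<and>
      r = vec_space.rank m A \<and>
      L \<in> carrier_mat r r \<and> unit_lower_triangular L \<and>
      M \<in> carrier_mat (m - r) r \<and>
      U \<in> carrier_mat r r \<and> upper_triangular U \<and>
      V \<in> carrier_mat r (n - r) \<and>
      A = P * (L @\<^sub>r M) * (U @\<^sub>c V) * Q"
proof -
  obtain P Q r L M U V where run: "PLUQ m n A = (P, Q, r, L, M, U, V)"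
    by (metis prod_cases7)
  have ok: "is_PLUQ m n A (P, Q, r, L, M, U, V)"
    using PLUQ_correct[of A m n] assms by (simp add: run)
  note d = is_PLUQD[OF ok]
  have "A = P * (L @\<^sub>r M) * ((U @\<^sub>c V) * Q)" by (rule d(15)[symmetric])
  also have "\<dots> = P * (L @\<^sub>r M) * (U @\<^sub>c V) * Q"
    using d(3,4) by (subst assoc_mult_dim) (simp_all add: d(5-11,13,14) permutation_matE(1,2)[OF d(2)])
  finally have eq: "A = P * (L @\<^sub>r M) * (U @\<^sub>c V) * Q" .
  have "upper_triangular U" using d(12) by (simp add: nonsing_upper_triangular_def)
  then show ?thesis
    unfolding run Let_def prod.case
    by (intro conjI carrier_matI d eq is_PLUQ_rank[OF ok, symmetric])
qed

end
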